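(* For every integer $k\ge 3$ there exists a graph $G_k$ with the following properties: 1. $G_k$ contains a $(2k-1)$-comatching of size $2^k$. 2. $G_k$ admits a tree decomposition where every bag has size at most $6$ and every adhesion has size at most $2$. 3. $G_k$ is $K_{3,4}$-minor-free. 4. $G_k$ is $K_5$-minor-free. 5. The Euler genus of $G_k$ is between $2^{k-3}$ and $2^k$.
   Context: Graphs are finite, undirected and unweighted, and $\mathrm{dist}$ is the shortest-path (hop) distance. For a graph $G$ and an integer $d\ge1$, a $d$-comatching is a family $\mathcal{M}$ of pairs of vertices of $G$ such that $\mathrm{dist}(p,q)>d$ for every $(p,q)\in\mathcal{M}$, and $\mathrm{dist}(p,q')\le d$ for all distinct $(p,q),(p',q')\in\mathcal{M}$. In a tree decomposition, an adhesion is the intersection of the bags of two adjacent nodes of the tree. *)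

theory Defs
  imports "Graph_Theory.Graph_Theory" "HOL-Combinatorics.Orbits"
begin

text \<open>
  A finite simple undirected graph is a \<open>pair_graph\<close>: a finite, symmetric, loop-free relation
  \<open>parcs G\<close> on \<open>pverts G\<close>.  Each undirected edge \<open>uv\<close> is represented by the two arcs \<open>(u,v)\<close>
  and \<open>(v,u)\<close>.
\<close>

text \<open>Hop distance; it is \<open>\<infinity>\<close> between different components.\<close>

definition hop_dist :: "'a pair_pre_digraph \<Rightarrow> 'a \<Rightarrow> 'a \<Rightarrow> ereal" where
  "hop_dist G u v = wf_digraph.\<mu> (with_proj G) (\<lambda>_. 1) u v"

definition comatching :: "'a pair_pre_digraph \<Rightarrow> nat \<Rightarrow> ('a \<times> 'a) set \<Rightarrow> bool" where
  "comatching G d M \<longleftrightarrow>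
     M \<subseteq> pverts G \<times> pverts G \<and>
     (\<forall>(p, q) \<in> M. hop_dist G p q > ereal (real d)) \<and>
     (\<forall>(p, q) \<in> M. \<forall>(p', q') \<in> M. (p, q) \<noteq> (p', q') \<longrightarrow> hop_dist G p q' \<le> ereal (real d))"

text \<open>
  The library's \<open>tree\<close> is not usable here: its \<open>forest\<close> forbids directed cycles, and in a
  symmetric digraph every edge gives the directed cycle \<open>u, v, u\<close>.  The cycles of the undirected
  graph are the directed cycles of length at least 3.
\<close>

definition undirected_tree :: "'a pair_pre_digraph \<Rightarrow> bool" where
  "undirected_tree T \<longleftrightarrow>
     pair_graph T \<and>
     Digraph_Component.connected (with_proj T) \<and>
     (\<nexists>c. pre_digraph.cycle (with_proj T) c \<and> 3 \<le> length c)"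

definition tree_decomposition ::
    "'a pair_pre_digraph \<Rightarrow> 'b pair_pre_digraph \<Rightarrow> ('b \<Rightarrow> 'a set) \<Rightarrow> bool" where
  "tree_decomposition G T bag \<longleftrightarrow>
     undirected_tree T \<and>
     (\<Union>t \<in> pverts T. bag t) = pverts G \<and>
     (\<forall>(u, v) \<in> parcs G. \<exists>t \<in> pverts T. u \<in> bag t \<and> v \<in> bag t) \<and>
     (\<forall>v \<in> pverts G.
        Digraph_Component.connected (with_proj T \<restriction> {t \<in> pverts T. v \<in> bag t}))"

text \<open>
  Minors are given by models: \<open>B x\<close> is the branch set of \<open>x\<close>.  The predicate \<open>connected\<close> of the
  library includes non-emptiness.
\<close>

definition is_minor :: "'b pair_pre_digraph \<Rightarrow> 'a pair_pre_digraph \<Rightarrow> bool" where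
  "is_minor H G \<longleftrightarrow>
     (\<exists>B :: 'b \<Rightarrow> 'a set.
        (\<forall>x \<in> pverts H. B x \<subseteq> pverts G \<and>
                        Digraph_Component.connected (with_proj G \<restriction> B x)) \<and>
        (\<forall>x \<in> pverts H. \<forall>y \<in> pverts H. x \<noteq> y \<longrightarrow> B x \<inter> B y = {}) \<and>
        (\<forall>(x, y) \<in> parcs H. \<exists>u \<in> B x. \<exists>v \<in> B y. (u, v) \<in> parcs G))"

text \<open>
  Euler genus, via combinatorial embeddings (Mohar and Thomassen, Graphs on Surfaces, Chapters 3
  and 4).  A 2-cell embedding in a closed surface, orientable or not, is given by an embedding
  scheme: \<open>rot\<close> sends each arc leaving a vertex to the next one in the local clockwise order at
  that vertex, and \<open>tw\<close> is the signature, with \<open>tw e\<close> meaning that \<open>e\<close> has signature \<open>-1\<close>, i.e.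
  the local orientations at the ends of \<open>e\<close> disagree along \<open>e\<close>.
\<close>

definition embedding_scheme ::
    "'a pair_pre_digraph \<Rightarrow> ('a \<times> 'a \<Rightarrow> 'a \<times> 'a) \<Rightarrow> ('a \<times> 'a \<Rightarrow> bool) \<Rightarrow> bool" where
  "embedding_scheme G rot tw \<longleftrightarrow>
     rot permutes parcs G \<and>
     (\<forall>v \<in> pverts G. out_arcs (with_proj G) v \<noteq> {} \<longrightarrow>
        cyclic_on rot (out_arcs (with_proj G) v)) \<and>
     (\<forall>e \<in> parcs G. tw (prod.swap e) = tw e)"

text \<open>
  Face traversal.  In the state \<open>(e, b)\<close> the walk is about to traverse the arc \<open>e\<close>, and \<open>b\<close> tells
  whether it currently turns clockwise (\<open>rot\<close>) or anticlockwise (\<open>inv rot\<close>); a twisted edge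
  switches the mode.
\<close>

fun face_step ::
    "('a \<times> 'a \<Rightarrow> 'a \<times> 'a) \<Rightarrow> ('a \<times> 'a \<Rightarrow> bool) \<Rightarrow> ('a \<times> 'a) \<times> bool \<Rightarrow> ('a \<times> 'a) \<times> bool" where
  "face_step rot tw (e, b) =
     (let b' = (b \<noteq> tw e)
      in (if b' then rot (prod.swap e) else inv rot (prod.swap e), b'))"

text \<open>The state in which the same side of the edge is traversed in the opposite direction.\<close>

fun face_reverse :: "('a \<times> 'a \<Rightarrow> bool) \<Rightarrow> ('a \<times> 'a) \<times> bool \<Rightarrow> ('a \<times> 'a) \<times> bool" where
  "face_reverse tw (e, b) = (prod.swap e, \<not> (b \<noteq> tw e))"

text \<open>A face is a facial walk up to cyclic shift (hence an orbit) and reversal.\<close>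

definition facial_walks ::
    "'a pair_pre_digraph \<Rightarrow> ('a \<times> 'a \<Rightarrow> 'a \<times> 'a) \<Rightarrow> ('a \<times> 'a \<Rightarrow> bool)
      \<Rightarrow> (('a \<times> 'a) \<times> bool) set set" where
  "facial_walks G rot tw =
     (\<lambda>x. orbit (face_step rot tw) x \<union> orbit (face_step rot tw) (face_reverse tw x))
       ` (parcs G \<times> UNIV)"

text \<open>
  An isolated vertex lies on a sphere of its own and contributes one face, which is not seen by
  the arcs.
\<close>

definition num_faces ::
    "'a pair_pre_digraph \<Rightarrow> ('a \<times> 'a \<Rightarrow> 'a \<times> 'a) \<Rightarrow> ('a \<times> 'a \<Rightarrow> bool) \<Rightarrow> nat" where
  "num_faces G rot tw =
     card (facial_walks G rot tw) + card {v \<in> pverts G. out_arcs (with_proj G) v = {}}"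

text \<open>
  The Euler genus of an embedding of a connected graph is \<open>2 - (|V| - |E| + |F|)\<close>.  The components
  of a disconnected graph are embedded in separate surfaces, and their Euler genera are added
  (which is the Euler genus of the connected sum), whence the factor \<open>card sccs_verts\<close>, the number
  of components.
\<close>

definition scheme_euler_genus ::
    "'a pair_pre_digraph \<Rightarrow> ('a \<times> 'a \<Rightarrow> 'a \<times> 'a) \<Rightarrow> ('a \<times> 'a \<Rightarrow> bool) \<Rightarrow> int" where
  "scheme_euler_genus G rot tw =
     2 * int (card (pre_digraph.sccs_verts (with_proj G)))
     - (int (card (pverts G)) - int (card ((\<lambda>(u, v). {u, v}) ` parcs G))
        + int (num_faces G rot tw))"

text \<open>The set below is finite: all the quantities are bounded in terms of \<open>G\<close>.\<close>

definition euler_genus :: "'a pair_pre_digraph \<Rightarrow> int" where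
  "euler_genus G = Min {scheme_euler_genus G rot tw | rot tw. embedding_scheme G rot tw}"

end

theory Submission
  imports Defs "HOL-Combinatorics.Cycles" "HOL-Library.Countable" "HOL-Library.Sublist"
begin

text \<open>
  Take two copies of the complete binary tree of height \<open>h = k - 1\<close> and, for every pair of siblings
  at depth \<open>m\<close>, join each of them to the other one in the other copy by a path of length \<open>2 m + 1\<close>.
  From a leaf, all these paths are crossed in the middle after exactly \<open>h\<close> steps, so a leaf has distance
  at most \<open>2 h + 1 = 2 k - 1\<close> from every leaf of the other copy except its own twin, which is farther away.
  Using the pairs of twins in both directions gives \<open>2 ^ k\<close> pairs from trees with only \<open>2 ^ (k - 1)\<close>
  leaves.  A node, its two children and their twins form a hexagon whose long diagonals are
  the adhesions, hence a bag with a torso inside \<open>K\<^sub>3\<^sub>,\<^sub>3\<close>.  A minor that is not separated by two vertices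
  meets a single bag with all its branch sets, which excludes \<open>K\<^sub>5\<close> and \<open>K\<^sub>3\<^sub>,\<^sub>4\<close>.

  All these hexagons can be made faces at once, so the cycle rank \<open>2 ^ k - 3\<close> gives an Euler genus of
  at most about \<open>2 ^ (k - 1)\<close>.  There is then room for \<open>2 ^ (k - 3)\<close> disjoint copies of \<open>K\<^sub>3\<^sub>,\<^sub>3\<close>, which
  force the lower bound: each has Euler genus at least 1 because it is bipartite and
  facial walks have length at least 4, and the rest has Euler genus at least 0 by Euler's inequality.
\<close>

section \<open>Connectivity\<close>

text \<open>A crossing path joins a child \<open>b # v\<close> in one copy to the other child
  \<open>(\<not> b) # v\<close> in the other copy. Two distinct leaves split at their lowest common
  ancestor into different children, so one crossing fits them both. A leaf and its twin never split:
  at most one end of a crossing is an ancestor of their common word, so any route leaves the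
  ancestor line in one of the copies and pays 2 extra steps. A half path is as long as the depth of
  its start, which makes the cost of crossing independent of the depth of the common ancestor.

  The number of copies of K_{3,3} is tuned to a crude upper bound: each has Euler genus at most 4,
  so \<open>2 ^ (k - 3)\<close> of them take up \<open>2 ^ (k - 1)\<close>, and the hexagons keep
  the rest below \<open>2 ^ (k - 1)\<close>.

  Euler's inequality is needed for every scheme, nonorientable ones included, hence it is proved
  modulo 2: vertex cuts and boundaries of sets of faces are orthogonal families of edge sets, of
  dimensions |V| - 1 and |F| - 1, so these add up to at most |E|.\<close>

lemma connected_induce_iff:
  assumes "sym (parcs G)"
  shows "Digraph_Component.connected (with_proj G \<restriction> S) \<longleftrightarrow>
    S \<noteq> {} \<and> (\<forall>u\<in>S. \<forall>v\<in>S. (u, v) \<in> (parcs G \<inter> S \<times> S)\<^sup>*)"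
proof -
  let ?M = "mk_symmetric (with_proj G \<restriction> S)"
  have arcs: "parcs ?M = parcs G \<inter> S \<times> S"
    using assms by (auto simp: parcs_mk_symmetric dest: symD)
  have reach: "u \<rightarrow>\<^sup>*\<^bsub>with_proj ?M\<^esub> v \<longleftrightarrow> (u, v) \<in> (parcs G \<inter> S \<times> S)\<^sup>*"
    if "u \<in> S" "v \<in> S" for u v
    using rtrancl_consistent_rtrancl_on[of u v "parcs G \<inter> S \<times> S" S]
      rtrancl_on_rtranclI[of u v S "parcs G \<inter> S \<times> S"] that
    by (auto simp: reachable_def arcs)
  show ?thesis
    unfolding Digraph_Component.connected_def strongly_connected_def
    by (simp add: reach cong: ball_cong)
qed

lemma connected_induce_rootI:
  assumes "sym (parcs G)" "r \<in> S" "\<And>u. u \<in> S \<Longrightarrow> (u, r) \<in> (parcs G \<inter> S \<times> S)\<^sup>*"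
  shows "Digraph_Component.connected (with_proj G \<restriction> S)"
proof -
  have "sym ((parcs G \<inter> S \<times> S)\<^sup>*)"
    using assms(1) by (intro sym_rtrancl) (auto simp: sym_def)
  then have "(u, v) \<in> (parcs G \<inter> S \<times> S)\<^sup>*" if "u \<in> S" "v \<in> S" for u v
    using assms(3)[OF that(1)] assms(3)[OF that(2)] by (meson rtrancl_trans symE)
  then show ?thesis
    unfolding connected_induce_iff[OF assms(1)] using assms(2) by blast
qed

lemma rtrancl_exit:
  assumes "(u, w) \<in> R\<^sup>*" "P u" "\<not> P w"
  shows "\<exists>a b. (a, b) \<in> R \<and> P a \<and> \<not> P b"
  using assms by (induction rule: rtrancl_induct) blast+

lemma connected_induce_exit:
  assumes "Digraph_Component.connected (with_proj G \<restriction> S)" "sym (parcs G)"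
    and "u \<in> S" "P u" "w \<in> S" "\<not> P w"
  obtains a b where "(a, b) \<in> parcs G" "a \<in> S" "b \<in> S" "P a" "\<not> P b"
proof -
  have "(u, w) \<in> (parcs G \<inter> S \<times> S)\<^sup>*"
    using assms by (simp add: connected_induce_iff)
  then show thesis
    using rtrancl_exit[of u w _ P] assms(4,6) that by blast
qed

section \<open>Rooted trees and tree decompositions\<close>

lemma pcas_nth:
  assumes "pcas u p v" "p \<noteq> []"
  shows "fst (p ! 0) = u" "snd (p ! (length p - 1)) = v"
    "\<And>i. Suc i < length p \<Longrightarrow> fst (p ! Suc i) = snd (p ! i)"
proof -
  have "fst (p ! 0) = u \<and> snd (p ! (length p - 1)) = v \<and>
    (\<forall>i. Suc i < length p \<longrightarrow> fst (p ! Suc i) = snd (p ! i))"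
    using assms
  proof (induction p arbitrary: u)
    case (Cons e p)
    show ?case
    proof (cases "p = []")
      case False
      then show ?thesis
        using Cons.IH[of "snd e"] Cons.prems by (auto simp: nth_Cons split: nat.splits)
    qed (use Cons.prems in auto)
  qed simp
  then show "fst (p ! 0) = u" "snd (p ! (length p - 1)) = v"
    "\<And>i. Suc i < length p \<Longrightarrow> fst (p ! Suc i) = snd (p ! i)"
    by auto
qed

lemma tl_pawalk_verts:
  assumes "pcas u p v"
  shows "tl (pawalk_verts u p) = map snd p"
proof -
  have "pawalk_verts u p = u # map snd p"
    using assms by (induction p arbitrary: u) auto
  then show ?thesis by simp
qed

definition parent_tree :: "'b set \<Rightarrow> 'b \<Rightarrow> ('b \<Rightarrow> 'b) \<Rightarrow> 'b pair_pre_digraph" where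
  "parent_tree N r par = \<lparr> pverts = N,
     parcs = {(s, t). s \<in> N \<and> s \<noteq> r \<and> t = par s \<or> t \<in> N \<and> t \<noteq> r \<and> s = par t} \<rparr>"

text \<open>The strict drop of \<open>rk\<close> towards the root rules out cycles and is the
  measure for all inductions along the tree.\<close>

locale rooted_tree =
  fixes N :: "'b set" and r :: 'b and par :: "'b \<Rightarrow> 'b" and rk :: "'b \<Rightarrow> nat"
  assumes fin_nodes: "finite N"
    and root_in: "r \<in> N"
    and par_in: "t \<in> N \<Longrightarrow> t \<noteq> r \<Longrightarrow> par t \<in> N"
    and rk_par: "t \<in> N \<Longrightarrow> t \<noteq> r \<Longrightarrow> rk (par t) < rk t"
begin

abbreviation "T \<equiv> parent_tree N r par"

lemma sym_parcs_T: "sym (parcs T)"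
  by (auto simp: parent_tree_def sym_def)

lemma pair_graph_T: "pair_graph T"
proof
  show "fst e \<in> pverts T" "snd e \<in> pverts T" if "e \<in> parcs T" for e
    using that par_in by (auto simp: parent_tree_def)
  show "finite (pverts T)" by (simp add: parent_tree_def fin_nodes)
  have "parcs T \<subseteq> N \<times> N" using par_in by (auto simp: parent_tree_def)
  then show "finite (parcs T)" using fin_nodes finite_subset by blast
  show "fst e \<noteq> snd e" if "e \<in> parcs T" for e
  proof
    assume "fst e = snd e"
    with that obtain t where "t \<in> N" "t \<noteq> r" "t = par t"
      by (auto simp: parent_tree_def)
    with rk_par show False by fastforce
  qed
  show "symmetric (with_proj T)"
    using sym_parcs_T by (simp add: symmetric_def)
qed

lemma connected_T_induce:
  assumes "S \<subseteq> N" "x \<in> S" "\<And>t. t \<in> S \<Longrightarrow> t \<noteq> x \<Longrightarrow> t \<noteq> r \<and> par t \<in> S"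
  shows "Digraph_Component.connected (with_proj T \<restriction> S)"
proof (rule connected_induce_rootI[OF sym_parcs_T])
  show "(t, x) \<in> (parcs T \<inter> S \<times> S)\<^sup>*" if "t \<in> S" for t
    using that
  proof (induction "rk t" arbitrary: t rule: less_induct)
    case less
    show ?case
    proof (cases "t = x")
      case False
      with less.prems assms have p: "t \<noteq> r" "par t \<in> S" "t \<in> N" by auto
      then have "(t, par t) \<in> parcs T \<inter> S \<times> S"
        using less.prems by (auto simp: parent_tree_def)
      moreover have "(par t, x) \<in> (parcs T \<inter> S \<times> S)\<^sup>*"
        using less.hyps p rk_par by blast
      ultimately show ?thesis by (rule converse_rtrancl_into_rtrancl)
    qed simp
  qed
qed (use assms in auto)

lemma connected_T: "Digraph_Component.connected (with_proj T)"
proof -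
  have "with_proj T \<restriction> N = with_proj T"
    using par_in by (auto simp: parent_tree_def induce_subgraph_def with_proj_def)
  then show ?thesis
    using connected_T_induce[of N r] root_in par_in by simp
qed

text \<open>Around a cycle, the vertex of maximal rank has its parent on both sides.\<close>

lemma no_long_cycle_T:
  assumes "pre_digraph.cycle (with_proj T) c"
  shows "length c \<le> 2"
proof (rule ccontr)
  assume "\<not> length c \<le> 2"
  define n where "n = length c"
  have n: "n \<ge> 3" using \<open>\<not> length c \<le> 2\<close> by (simp add: n_def)
  interpret pair_graph T by (rule pair_graph_T)
  obtain u where u: "awalk u c u" "distinct (tl (pawalk_verts u c))" "c \<noteq> []"
    using assms unfolding cycle_def by auto
  then have cas: "pcas u c u" and sub: "set c \<subseteq> parcs T" by (auto simp: awalk_def)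
  have dist: "distinct (map snd c)"
    using u(2) tl_pawalk_verts[OF cas] by simp
  define f where "f i = snd (c ! (i mod n))" for i
  have arc: "(f i, f (Suc i)) \<in> parcs T" for i
  proof -
    have "fst (c ! (Suc i mod n)) = f i"
    proof (cases "Suc i mod n = 0")
      case True
      then have "i mod n = n - 1"
        using n by (metis mod_Suc diff_Suc_1 nat.distinct(1))
      then show ?thesis
        using True pcas_nth(1,2)[OF cas u(3)] by (simp add: f_def n_def)
    next
      case False
      then have "Suc i mod n = Suc (i mod n)" by (metis mod_Suc)
      moreover have "Suc (i mod n) < n"
        using n calculation by (metis mod_less_divisor zero_less_numeral order_less_le_trans)
      ultimately show ?thesis
        using pcas_nth(3)[OF cas u(3)] by (simp add: f_def n_def)
    qed
    moreover have "c ! (Suc i mod n) \<in> parcs T"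
    proof -
      have "Suc i mod n < length c" using n by (simp add: n_def[symmetric])
      then show ?thesis using sub nth_mem by blast
    qed
    ultimately show ?thesis by (metis f_def prod.collapse)
  qed
  have inj: "i mod n = j mod n" if "f i = f j" for i j
  proof -
    have "i mod n < length c" "j mod n < length c" using n by (simp_all add: n_def[symmetric])
    then show ?thesis
      using that nth_eq_iff_index_eq[OF dist, of "i mod n" "j mod n"] by (simp add: f_def)
  qed
  have "\<exists>i. \<forall>j. rk (f j) \<le> rk (f i)"
  proof -
    have "finite (range f)"
      by (rule finite_subset[of _ "(\<lambda>i. snd (c ! i)) ` {..<n}"]) (use n in \<open>auto simp: f_def\<close>)
    then have "Max (rk ` range f) \<in> rk ` range f" by (intro Max_in) auto
    then obtain i where "Max (rk ` range f) = rk (f i)" by auto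
    then show ?thesis
      using \<open>finite (range f)\<close> by (metis Max_ge finite_imageI imageI rangeI)
  qed
  then obtain i where i: "\<And>j. rk (f j) \<le> rk (f i)" by blast
  \<comment> \<open>The shift by \<open>n\<close> makes the predecessor index
    \<open>i + n - 1\<close> available in the natural numbers.\<close>
  then have i': "rk (f j) \<le> rk (f (i + n))" for j
    by (simp add: f_def)
  have up: "y = par x" if "(x, y) \<in> parcs T \<or> (y, x) \<in> parcs T" "rk y \<le> rk x" for x y
    using that rk_par by (fastforce simp: parent_tree_def)
  have "f (Suc (i + n)) = par (f (i + n))"
    using up arc i' by blast
  moreover have "f (i + n - 1) = par (f (i + n))"
    using up[of "f (i + n)" "f (i + n - 1)"] arc[of "i + n - 1"] i' n by simp
  ultimately have "Suc (i + n) mod n = (i + n - 1) mod n"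
    using inj by metis
  then have "n dvd Suc (i + n) - (i + n - 1)"
    by (metis mod_eq_dvd_iff_nat diff_le_self le_SucI)
  then have "n dvd 2" using n by simp
  then show False using n by (auto dest: dvd_imp_le)
qed

lemma undirected_tree_T: "undirected_tree T"
  unfolding undirected_tree_def
  using pair_graph_T connected_T no_long_cycle_T by force

text \<open>To be read with the ancestor first: in \<open>below t s\<close>, the node
  \<open>s\<close> lies in the subtree of \<open>t\<close>.\<close>

inductive below :: "'b \<Rightarrow> 'b \<Rightarrow> bool" for t where
  refl: "t \<in> N \<Longrightarrow> below t t"
| step: "s \<in> N \<Longrightarrow> s \<noteq> r \<Longrightarrow> below t (par s) \<Longrightarrow> below t s"

lemma below_trans: "below s u \<Longrightarrow> below t s \<Longrightarrow> below t u"
  by (induction rule: below.induct) (auto intro: below.step)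

lemma below_rk: "below t s \<Longrightarrow> rk t \<le> rk s"
  by (induction rule: below.induct) (use rk_par in fastforce)+

lemma below_root: "t \<in> N \<Longrightarrow> below r t"
proof (induction "rk t" arbitrary: t rule: less_induct)
  case less
  then show ?case
    using rk_par par_in by (cases "t = r") (auto intro: below.intros)
qed

lemma below_child:
  assumes "below t s" "s \<noteq> t"
  obtains c where "c \<in> N" "c \<noteq> r" "par c = t" "below c s"
proof -
  have "\<exists>c. c \<in> N \<and> c \<noteq> r \<and> par c = t \<and> below c s"
    using assms
  proof (induction rule: below.induct)
    case (step s)
    then show ?case
      by (cases "par s = t") (auto intro: below.intros)
  qed simp
  then show thesis using that by blast
qed

end

text \<open>Connectedness of the set of nodes whose bag contains \<open>v\<close> is encoded by its
  highest node \<open>top v\<close>: from any such node one can climb inside the set until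
  \<open>top v\<close> is reached. In this form it can be checked locally, one tree edge at a
  time.\<close>

locale rooted_decomposition = rooted_tree N r par rk
  for N :: "'b set" and r :: 'b and par :: "'b \<Rightarrow> 'b" and rk :: "'b \<Rightarrow> nat" +
  fixes G :: "'a pair_pre_digraph" and bag :: "'b \<Rightarrow> 'a set" and top :: "'a \<Rightarrow> 'b"
  assumes graph: "pair_graph G"
    and bag_sub: "t \<in> N \<Longrightarrow> bag t \<subseteq> pverts G"
    and top_in: "v \<in> pverts G \<Longrightarrow> top v \<in> N \<and> v \<in> bag (top v)"
    and bag_par: "t \<in> N \<Longrightarrow> v \<in> bag t \<Longrightarrow> t \<noteq> top v \<Longrightarrow> t \<noteq> r \<and> v \<in> bag (par t)"
    and arc_bag: "(u, v) \<in> parcs G \<Longrightarrow> \<exists>t\<in>N. u \<in> bag t \<and> v \<in> bag t"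
begin

lemma sym_parcs: "sym (parcs G)"
proof -
  interpret pair_graph G by (rule graph)
  show ?thesis using sym_arcs by (simp add: symmetric_def)
qed

lemma fin_verts: "finite (pverts G)"
proof -
  interpret pair_graph G by (rule graph)
  show ?thesis by simp
qed

lemma fin_bag: "t \<in> N \<Longrightarrow> finite (bag t)"
  using bag_sub fin_verts finite_subset by blast

lemma arc_verts: "(u, v) \<in> parcs G \<Longrightarrow> u \<in> pverts G \<and> v \<in> pverts G"
  using arc_bag bag_sub by blast

lemma tree_decomposition: "tree_decomposition G T bag"
proof -
  have conn: "Digraph_Component.connected (with_proj T \<restriction> {t \<in> pverts T. v \<in> bag t})"
    if "v \<in> pverts G" for v
    using that top_in bag_par par_in
    by (intro connected_T_induce[where x = "top v"]) (auto simp: parent_tree_def)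
  moreover have "pverts T = N" by (simp add: parent_tree_def)
  ultimately show ?thesis
    unfolding tree_decomposition_def
    using undirected_tree_T bag_sub top_in arc_bag by blast
qed

text \<open>The empty adhesion at the root lets the separation lemmas hold uniformly for all
  nodes.\<close>

definition adh :: "'b \<Rightarrow> 'a set" where
  "adh t = (if t = r then {} else bag t \<inter> bag (par t))"

text \<open>These are the vertices all of whose bags lie in the subtree of \<open>t\<close>, that
  is, the part strictly below the adhesion.\<close>

definition inner :: "'b \<Rightarrow> 'a set" where
  "inner t = {v \<in> pverts G. below t (top v)}"

lemma below_top:
  assumes "s \<in> N" "v \<in> bag s"
  shows "below (top v) s"
  using assms
proof (induction "rk s" arbitrary: s rule: less_induct)
  case less
  show ?case
  proof (cases "s = top v")
    case False
    with less.prems bag_par have "s \<noteq> r" "v \<in> bag (par s)" by auto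
    then show ?thesis
      using less rk_par par_in by (blast intro: below.step)
  qed (use less in \<open>auto intro: below.refl\<close>)
qed

text \<open>Climbing from \<open>s\<close> towards \<open>top v\<close> stays in bags containing
  \<open>v\<close>; since \<open>top v\<close> is outside the subtree of \<open>t\<close>, the climb
  passes through \<open>t\<close> and on to its parent.\<close>

lemma in_adh:
  assumes "below t s" "v \<in> bag s" "\<not> below t (top v)"
  shows "v \<in> adh t"
  using assms
proof (induction rule: below.induct)
  case refl
  then have "t \<noteq> top v" by (auto intro: below.refl)
  then show ?case using refl bag_par by (auto simp: adh_def)
next
  case (step s)
  then have "s \<noteq> top v" by (auto intro: below.step)
  then show ?case using step bag_par by blast
qed

text \<open>The adhesion separates: a bag containing both ends lies in the subtree of
  \<open>t\<close> because of \<open>u\<close>, so \<open>v\<close> reaches outside only through the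
  adhesion.\<close>

lemma arc_inner_exit:
  assumes "(u, v) \<in> parcs G" "u \<in> inner t" "v \<notin> inner t"
  shows "v \<in> adh t"
proof -
  obtain s where s: "s \<in> N" "u \<in> bag s" "v \<in> bag s" using arc_bag assms(1) by blast
  then have "below t s"
    using below_top[of s u] assms(2) below_trans by (auto simp: inner_def)
  then show ?thesis
    using in_adh s assms arc_verts by (auto simp: inner_def)
qed

lemma inner_disjoint_bag_par:
  assumes "t \<in> N" "t \<noteq> r"
  shows "inner t \<inter> bag (par t) = {}"
proof -
  have False if "u \<in> inner t" "u \<in> bag (par t)" for u
  proof -
    have "below t (par t)"
      using below_top[of "par t" u] that assms par_in below_trans by (auto simp: inner_def)
    then show False using below_rk rk_par assms by fastforce
  qed
  then show ?thesis by blast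
qed

lemma inner_child:
  assumes "u \<in> inner t" "u \<notin> bag t"
  obtains c where "c \<in> N" "c \<noteq> r" "par c = t" "u \<in> inner c"
proof -
  have "top u \<noteq> t" using assms top_in by (auto simp: inner_def)
  then show thesis
    using below_child[of t "top u"] assms(1) that by (auto simp: inner_def)
qed

lemma adh_sub_bag: "adh t \<subseteq> bag t" "c \<noteq> r \<Longrightarrow> adh c \<subseteq> bag (par c)"
  by (auto simp: adh_def)

lemma connected_sub_inner:
  assumes "Digraph_Component.connected (with_proj G \<restriction> S)" "S \<inter> adh t = {}" "u \<in> S" "u \<in> inner t"
  shows "S \<subseteq> inner t"
proof
  fix w assume "w \<in> S"
  show "w \<in> inner t"
  proof (rule ccontr)
    assume "w \<notin> inner t"
    then obtain a b where "(a, b) \<in> parcs G" "b \<in> S" "a \<in> inner t" "b \<notin> inner t"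
      using connected_induce_exit[OF assms(1) sym_parcs \<open>u \<in> S\<close>, of "\<lambda>v. v \<in> inner t" w]
        assms \<open>w \<in> S\<close> by blast
    then show False using arc_inner_exit assms(2) by blast
  qed
qed

end

section \<open>Excluding minors\<close>

text \<open>The only consequence of 3-connectedness that is needed: no two other vertices separate
  \<open>x\<close> from \<open>y\<close>.\<close>

definition linked :: "'c pair_pre_digraph \<Rightarrow> bool" where
  "linked H \<longleftrightarrow> (\<forall>x\<in>pverts H. \<forall>y\<in>pverts H. x \<noteq> y \<longrightarrow> (x, y) \<in> parcs H \<or>
     (\<exists>Z\<subseteq>pverts H. card Z = 3 \<and> (\<forall>z\<in>Z. (x, z) \<in> parcs H \<and> (z, y) \<in> parcs H)))"

lemma linked_complete:
  assumes "K\<^bsub>n\<^esub> (with_proj H)"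
  shows "linked H"
proof -
  have "parcs H = {(x, y). (x, y) \<in> pverts H \<times> pverts H \<and> x \<noteq> y}"
    using assms unfolding complete_digraph_pair_def by blast
  then have "(x, y) \<in> parcs H" if "x \<in> pverts H" "y \<in> pverts H" "x \<noteq> y" for x y
    using that by simp
  then show ?thesis unfolding linked_def by simp
qed

lemma linked_complete_bipartite:
  assumes "K\<^bsub>m,n\<^esub> (with_proj H)" "m \<ge> 3" "n \<ge> 3"
  shows "linked H"
proof -
  obtain U V where UV: "pverts H = U \<union> V" "card U = m" "card V = n"
    "parcs H = U \<times> V \<union> V \<times> U"
    using assms(1) unfolding complete_bipartite_digraph_pair_def by blast
  obtain A where A: "A \<subseteq> U" "card A = 3"
    using obtain_subset_with_card_n[of 3 U] UV(2) assms(2) by metis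
  obtain B where B: "B \<subseteq> V" "card B = 3"
    using obtain_subset_with_card_n[of 3 V] UV(3) assms(3) by metis
  show ?thesis
    unfolding linked_def
  proof (intro ballI impI)
    fix x y assume xy: "x \<in> pverts H" "y \<in> pverts H"
    consider "x \<in> U" "y \<in> U" | "x \<in> V" "y \<in> V" | "(x, y) \<in> parcs H"
      using xy UV by blast
    then show "(x, y) \<in> parcs H \<or>
      (\<exists>Z\<subseteq>pverts H. card Z = 3 \<and> (\<forall>z\<in>Z. (x, z) \<in> parcs H \<and> (z, y) \<in> parcs H))"
    proof cases
      case 1
      then show ?thesis using B UV by (intro disjI2 exI[of _ B]) auto
    next
      case 2
      then show ?thesis using A UV by (intro disjI2 exI[of _ A]) auto
    qed simp
  qed
qed

text \<open>The colouring is a bipartition that gives the two vertices of an adhesion different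
  colours. Hence adhesions have at most two vertices, and adding them as edges keeps every torso
  bipartite.\<close>

locale coloured_decomposition = rooted_decomposition N r par rk G bag top
  for N :: "'b set" and r :: 'b and par :: "'b \<Rightarrow> 'b" and rk :: "'b \<Rightarrow> nat"
    and G :: "'a pair_pre_digraph" and bag :: "'b \<Rightarrow> 'a set" and top :: "'a \<Rightarrow> 'b" +
  fixes col :: "'a \<Rightarrow> bool"
  assumes col_arc: "(u, v) \<in> parcs G \<Longrightarrow> col u \<noteq> col v"
    and inj_col_adh: "t \<in> N \<Longrightarrow> t \<noteq> r \<Longrightarrow> inj_on col (bag t \<inter> bag (par t))"
    and col_bag: "t \<in> N \<Longrightarrow> card {v \<in> bag t. col v = c} \<le> 3"
begin

lemma card_bag:
  assumes "t \<in> N"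
  shows "card (bag t) \<le> 6"
proof -
  have "bag t = {v \<in> bag t. col v = True} \<union> {v \<in> bag t. col v = False}" by auto
  then have "card (bag t) \<le> card {v \<in> bag t. col v = True} + card {v \<in> bag t. col v = False}"
    by (metis card_Un_le)
  then show ?thesis using col_bag[OF assms, of True] col_bag[OF assms, of False] by linarith
qed

lemma inj_on_adh: "t \<in> N \<Longrightarrow> inj_on col (adh t)"
  using inj_col_adh by (auto simp: adh_def)

lemma finite_adh: "t \<in> N \<Longrightarrow> finite (adh t)"
  using adh_sub_bag(1) fin_bag finite_subset by blast

lemma card_adh: "t \<in> N \<Longrightarrow> card (adh t) \<le> 2"
  using card_inj_on_le[OF inj_on_adh, of t UNIV] by simp

lemma card_adhesion:
  assumes "(s, t) \<in> parcs T"
  shows "card (bag s \<inter> bag t) \<le> 2"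
proof -
  have "s \<in> N \<and> s \<noteq> r \<and> bag s \<inter> bag t = adh s \<or> t \<in> N \<and> t \<noteq> r \<and> bag s \<inter> bag t = adh t"
    using assms by (auto simp: parent_tree_def adh_def)
  then show ?thesis using card_adh by auto
qed

definition minor_model :: "'c pair_pre_digraph \<Rightarrow> ('c \<Rightarrow> 'a set) \<Rightarrow> bool" where
  "minor_model H B \<longleftrightarrow>
     (\<forall>x \<in> pverts H. B x \<subseteq> pverts G \<and> Digraph_Component.connected (with_proj G \<restriction> B x)) \<and>
     (\<forall>x \<in> pverts H. \<forall>y \<in> pverts H. x \<noteq> y \<longrightarrow> B x \<inter> B y = {}) \<and>
     (\<forall>(x, y) \<in> parcs H. \<exists>u \<in> B x. \<exists>v \<in> B y. (u, v) \<in> parcs G)"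

lemma minor_modelD:
  assumes "minor_model H B"
  shows "x \<in> pverts H \<Longrightarrow> B x \<subseteq> pverts G"
    "x \<in> pverts H \<Longrightarrow> Digraph_Component.connected (with_proj G \<restriction> B x)"
    "x \<in> pverts H \<Longrightarrow> y \<in> pverts H \<Longrightarrow> x \<noteq> y \<Longrightarrow> B x \<inter> B y = {}"
    "(x, y) \<in> parcs H \<Longrightarrow> \<exists>u\<in>B x. \<exists>v\<in>B y. (u, v) \<in> parcs G"
  using assms unfolding minor_model_def by blast+

section \<open>Branch sets of a minor model and how adhesions separate them\<close>

context
  fixes H :: "'c pair_pre_digraph" and B :: "'c \<Rightarrow> 'a set"
  assumes model: "minor_model H B"
begin

lemmas branch = minor_modelD(1,2)[OF model]
lemmas disj = minor_modelD(3)[OF model]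
lemmas arcs = minor_modelD(4)[OF model]

lemma branch_ne: "x \<in> pverts H \<Longrightarrow> B x \<noteq> {}"
  using branch(2) connected_induce_iff[OF sym_parcs] by blast

lemma neighbour_sub_inner:
  assumes "(x, y) \<in> parcs H" "y \<in> pverts H" "B x \<subseteq> inner t" "B y \<inter> adh t = {}"
  shows "B y \<subseteq> inner t"
proof -
  obtain u v where uv: "u \<in> B x" "v \<in> B y" "(u, v) \<in> parcs G" using arcs assms(1) by blast
  then have "v \<in> inner t" using arc_inner_exit assms by blast
  then show ?thesis using connected_sub_inner branch(2) assms uv by blast
qed

text \<open>The node is chosen as deep as possible such that some branch set lies strictly below the
  adhesion to its parent.\<close>

lemma bag_meets_all:
  assumes "linked H" "pverts H \<noteq> {}"
  obtains t where "t \<in> N" "\<And>x. x \<in> pverts H \<Longrightarrow> B x \<inter> bag t \<noteq> {}"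
proof -
  define P where "P t \<longleftrightarrow> t \<in> N \<and> (\<exists>x\<in>pverts H. B x \<subseteq> inner t)" for t
  have "inner r = pverts G" using below_root top_in by (auto simp: inner_def)
  then have "P r" using assms(2) branch(1) root_in by (auto simp: P_def)
  moreover have "finite (rk ` {t. P t})" using fin_nodes by (simp add: P_def)
  ultimately obtain t where t: "P t" and max: "\<And>s. P s \<Longrightarrow> rk s \<le> rk t"
    by (metis (mono_tags) Max_ge Max_in empty_iff imageE imageI mem_Collect_eq)
  then have tN: "t \<in> N" by (simp add: P_def)
  obtain x where x: "x \<in> pverts H" "B x \<subseteq> inner t" using t by (auto simp: P_def)
  have "B y \<inter> bag t \<noteq> {}" if y: "y \<in> pverts H" for y
  proof
    assume empty: "B y \<inter> bag t = {}"
    then have empty': "B y \<inter> adh t = {}" using adh_sub_bag(1) by blast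
    have "B y \<subseteq> inner t"
    proof (cases "x = y \<or> (x, y) \<in> parcs H")
      case True
      then show ?thesis using x y neighbour_sub_inner empty' by blast
    next
      case False
      then obtain Z where Z: "Z \<subseteq> pverts H" "card Z = 3"
        "\<And>z. z \<in> Z \<Longrightarrow> (x, z) \<in> parcs H \<and> (z, y) \<in> parcs H"
        using assms(1) x(1) y unfolding linked_def by meson
      \<comment> \<open>Three disjoint branch sets cannot all meet an adhesion of at most two
        vertices, so one common neighbour carries the argument from \<open>x\<close> to
        \<open>y\<close>.\<close>
      have "\<exists>z\<in>Z. B z \<inter> adh t = {}"
      proof (rule ccontr)
        assume "\<not> ?thesis"
        then have "\<forall>z\<in>Z. \<exists>a. a \<in> B z \<inter> adh t" by blast
        then obtain g where g: "\<And>z. z \<in> Z \<Longrightarrow> g z \<in> B z \<inter> adh t" by metis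
        have "inj_on g Z"
        proof (rule inj_onI, rule ccontr)
          fix z z' assume z: "z \<in> Z" "z' \<in> Z" "g z = g z'" "z \<noteq> z'"
          then show False using disj[of z z'] Z(1) g[of z] g[of z'] by auto
        qed
        then have "card Z \<le> card (adh t)"
          using g card_inj_on_le finite_adh[OF tN] by blast
        then show False using Z(2) card_adh[OF tN] by simp
      qed
      then obtain z where z: "z \<in> Z" "B z \<inter> adh t = {}" by blast
      then have "B z \<subseteq> inner t" using neighbour_sub_inner Z x by blast
      then show ?thesis using neighbour_sub_inner Z z y empty' by blast
    qed
    \<comment> \<open>A connected set inside \<open>inner t\<close> that avoids the bag of
      \<open>t\<close> lies below a single child \<open>c\<close>, whose larger rank contradicts the
      choice of \<open>t\<close>.\<close>
    obtain u where u: "u \<in> B y" using branch_ne[OF y] by blast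
    then obtain c where c: "c \<in> N" "c \<noteq> r" "par c = t" "u \<in> inner c"
      using inner_child[of u t] \<open>B y \<subseteq> inner t\<close> empty by blast
    then have "B y \<inter> adh c = {}" using adh_sub_bag(2)[of c] empty by blast
    then have "B y \<subseteq> inner c" using connected_sub_inner branch(2) y c u by blast
    then have "rk c \<le> rk t" using max c y by (auto simp: P_def)
    then show False using rk_par c by fastforce
  qed
  then show thesis using that tN by blast
qed

text \<open>A connected set with vertices on both sides of an adhesion has to meet it. Here the bag
  \<open>s\<close> is inside the subtree and the other bag is that of the parent;
  \<open>meets_adh_above\<close> is the case where \<open>s\<close> is outside.\<close>

lemma meets_adh_below:
  assumes "c \<in> N" "c \<noteq> r" "below c s" "x \<in> pverts H"
    and "u \<in> B x" "u \<in> bag s" "a \<in> B x" "a \<in> bag (par c)"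
  shows "B x \<inter> adh c \<noteq> {}"
proof
  assume *: "B x \<inter> adh c = {}"
  have "u \<in> pverts G" using assms(4,5) branch(1) by blast
  moreover have "below c (top u)" using in_adh[of c s u] assms * by blast
  ultimately have "u \<in> inner c" by (simp add: inner_def)
  then have "B x \<subseteq> inner c"
    using connected_sub_inner[OF branch(2)[OF assms(4)] *] assms(5) by blast
  then show False using inner_disjoint_bag_par[OF assms(1,2)] assms(7,8) by blast
qed

lemma meets_adh_above:
  assumes "t \<in> N" "s \<in> N" "\<not> below t s" "x \<in> pverts H"
    and "u \<in> B x" "u \<in> bag s" "a \<in> B x" "a \<in> bag t"
  shows "B x \<inter> adh t \<noteq> {}"
proof
  assume *: "B x \<inter> adh t = {}"
  have "\<not> below t (top u)" using below_top[of s u] below_trans assms by blast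
  then have u: "u \<notin> inner t" by (simp add: inner_def)
  have "below t t" using assms(1) by (rule below.refl)
  then have "below t (top a)" using in_adh[of t t a] assms * by blast
  moreover have "a \<in> pverts G" using assms(4,7) branch(1) by blast
  ultimately have "a \<in> inner t" by (simp add: inner_def)
  then have "B x \<subseteq> inner t"
    using connected_sub_inner[OF branch(2)[OF assms(4)] *] assms(7) by blast
  then show False using u assms(5) by blast
qed

text \<open>If the arc between the branch sets lives in the bag of \<open>t\<close>, its ends have
  different colours. Otherwise both branch sets pass through the same adhesion of \<open>t\<close>,
  towards the bag of the arc, and disjointness gives them different vertices of it, again of
  different colours.\<close>

lemma torso_arc:
  assumes "(x, y) \<in> parcs H" "x \<in> pverts H" "y \<in> pverts H" "x \<noteq> y"
    and "t \<in> N" "B x \<inter> bag t \<noteq> {}" "B y \<inter> bag t \<noteq> {}"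
  obtains a b where "a \<in> B x \<inter> bag t" "b \<in> B y \<inter> bag t" "col a \<noteq> col b"
proof -
  obtain u v where uv: "u \<in> B x" "v \<in> B y" "(u, v) \<in> parcs G" using arcs assms(1) by blast
  obtain s where s: "s \<in> N" "u \<in> bag s" "v \<in> bag s" using arc_bag uv by blast
  show thesis
  proof (cases "s = t")
    case True
    then show thesis using that uv s col_arc by blast
  next
    case False
    obtain a' b' where ab': "a' \<in> B x" "a' \<in> bag t" "b' \<in> B y" "b' \<in> bag t" using assms by blast
    have "\<exists>c\<in>N. adh c \<subseteq> bag t \<and> B x \<inter> adh c \<noteq> {} \<and> B y \<inter> adh c \<noteq> {}"
    proof (cases "below t s")
      case True
      then obtain c where c: "c \<in> N" "c \<noteq> r" "par c = t" "below c s"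
        using below_child \<open>s \<noteq> t\<close> by blast
      then have "adh c \<subseteq> bag t" using adh_sub_bag(2) by blast
      moreover have "B x \<inter> adh c \<noteq> {}"
        using meets_adh_below[OF c(1,2,4) assms(2) uv(1) s(2) ab'(1)] ab'(2) c(3) by simp
      moreover have "B y \<inter> adh c \<noteq> {}"
        using meets_adh_below[OF c(1,2,4) assms(3) uv(2) s(3) ab'(3)] ab'(4) c(3) by simp
      ultimately show ?thesis using c(1) by blast
    next
      case False
      then show ?thesis
        using meets_adh_above[OF assms(5) s(1) False assms(2) uv(1) s(2) ab'(1,2)]
          meets_adh_above[OF assms(5) s(1) False assms(3) uv(2) s(3) ab'(3,4)]
          assms(5) adh_sub_bag(1) by blast
    qed
    then obtain c where c: "c \<in> N" "adh c \<subseteq> bag t" "B x \<inter> adh c \<noteq> {}" "B y \<inter> adh c \<noteq> {}"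
      by blast
    then obtain a b where ab: "a \<in> B x" "a \<in> adh c" "b \<in> B y" "b \<in> adh c" by blast
    then have "a \<noteq> b" using disj assms by blast
    then have "col a \<noteq> col b" using ab inj_on_adh[OF c(1)] by (auto dest: inj_onD)
    then show thesis using that ab c by blast
  qed
qed

end

lemma minor_model_meets:
  assumes "minor_model H B" "linked H" "pverts H \<noteq> {}"
  obtains t g where "t \<in> N" "\<And>x. x \<in> pverts H \<Longrightarrow> g x \<in> B x \<inter> bag t" "inj_on g (pverts H)"
proof -
  note B = minor_modelD[OF assms(1)]
  obtain t where t: "t \<in> N" "\<And>x. x \<in> pverts H \<Longrightarrow> B x \<inter> bag t \<noteq> {}"
    using bag_meets_all[OF assms] by blast
  then have "\<forall>x\<in>pverts H. \<exists>v. v \<in> B x \<inter> bag t" by blast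
  then obtain g where g: "\<And>x. x \<in> pverts H \<Longrightarrow> g x \<in> B x \<inter> bag t" by metis
  have "inj_on g (pverts H)"
  proof (rule inj_onI, rule ccontr)
    fix x y assume "x \<in> pverts H" "y \<in> pverts H" "g x = g y" "x \<noteq> y"
    then show False using B(3)[of x y] g[of x] g[of y] by auto
  qed
  then show thesis using that t(1) g by blast
qed

text \<open>Size alone decides: seven disjoint branch sets would need seven representatives in one
  bag of at most six vertices.\<close>

theorem no_K34_minor:
  assumes "K\<^bsub>3,4\<^esub> (with_proj H)"
  shows "\<not> is_minor H G"
proof
  assume "is_minor H G"
  then obtain B where B: "minor_model H B" unfolding is_minor_def minor_model_def by blast
  have card: "card (pverts H) = 7"
    using assms unfolding complete_bipartite_digraph_pair_def
    by (auto simp: card_Un_disjoint)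
  have "linked H" using linked_complete_bipartite[OF assms] by simp
  moreover have "pverts H \<noteq> {}" using card by auto
  ultimately obtain t g where g: "t \<in> N" "\<And>x. x \<in> pverts H \<Longrightarrow> g x \<in> B x \<inter> bag t"
    "inj_on g (pverts H)"
    using minor_model_meets[OF B] by blast
  then have "card (pverts H) \<le> card (bag t)"
    by (intro card_inj_on_le[OF g(3)] fin_bag) blast+
  then show False using card card_bag[OF g(1)] by simp
qed

text \<open>With the adhesions added as edges, a bag spans a bipartite graph with at most three vertices
  on each side, hence with at most 9 edges.\<close>

theorem no_K5_minor:
  assumes "K\<^bsub>5\<^esub> (with_proj H)"
  shows "\<not> is_minor H G"
proof
  assume "is_minor H G"
  then obtain B where B: "minor_model H B" unfolding is_minor_def minor_model_def by blast
  have H: "finite (pverts H)" "card (pverts H) = 5"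
    "parcs H = {(x, y). (x, y) \<in> pverts H \<times> pverts H \<and> x \<noteq> y}"
    using assms unfolding complete_digraph_pair_def by auto
  then have "pverts H \<noteq> {}" by auto
  then obtain t h where t: "t \<in> N" "\<And>x. x \<in> pverts H \<Longrightarrow> h x \<in> B x \<inter> bag t"
    using minor_model_meets[OF B linked_complete[OF assms]] by blast
  have "\<forall>q\<in>parcs H. \<exists>p. fst p \<in> B (fst q) \<inter> bag t \<and> snd p \<in> B (snd q) \<inter> bag t \<and>
    col (fst p) \<noteq> col (snd p)"
  proof
    fix q assume q: "q \<in> parcs H"
    obtain x y where xy: "q = (x, y)" by (cases q)
    then have "(x, y) \<in> parcs H" "x \<in> pverts H" "y \<in> pverts H" "x \<noteq> y" using q H(3) by auto
    moreover from this have "B x \<inter> bag t \<noteq> {}" "B y \<inter> bag t \<noteq> {}" using t(2) by blast+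
    ultimately obtain a b where "a \<in> B x \<inter> bag t" "b \<in> B y \<inter> bag t" "col a \<noteq> col b"
      using torso_arc[OF B] t(1) by metis
    then show "\<exists>p. fst p \<in> B (fst q) \<inter> bag t \<and> snd p \<in> B (snd q) \<inter> bag t \<and>
      col (fst p) \<noteq> col (snd p)"
      using xy by (intro exI[of _ "(a, b)"]) simp
  qed
  then obtain g where g: "\<And>q. q \<in> parcs H \<Longrightarrow> fst (g q) \<in> B (fst q) \<inter> bag t \<and>
    snd (g q) \<in> B (snd q) \<inter> bag t \<and> col (fst (g q)) \<noteq> col (snd (g q))"
    by metis
  \<comment> \<open>Arcs are ordered pairs, so the at most 9 edges of the torso become 18, against
    the 20 arcs of K_5.\<close>
  let ?C = "\<lambda>c. {v \<in> bag t. col v = c}"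
  let ?P = "?C True \<times> ?C False \<union> ?C False \<times> ?C True"
  have fin: "finite (?C c)" for c using fin_bag[OF t(1)] by simp
  have sub: "g ` parcs H \<subseteq> ?P"
  proof
    fix p assume "p \<in> g ` parcs H"
    then obtain q where "q \<in> parcs H" "p = g q" by blast
    then show "p \<in> ?P" using g[of q] by (auto simp: mem_Times_iff)
  qed
  have "inj_on g (parcs H)"
  proof (rule inj_onI)
    fix q q' assume q: "q \<in> parcs H" "q' \<in> parcs H" and eq: "g q = g q'"
    have "fst q \<in> pverts H" "fst q' \<in> pverts H" "snd q \<in> pverts H" "snd q' \<in> pverts H"
      using q unfolding H(3) by auto
    then have "fst q = fst q'" "snd q = snd q'"
      using g[OF q(1)] g[OF q(2)] minor_modelD(3)[OF B, of "fst q" "fst q'"]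
        minor_modelD(3)[OF B, of "snd q" "snd q'"] unfolding eq by blast+
    then show "q = q'" by (rule prod_eqI)
  qed
  then have "card (parcs H) \<le> card ?P"
    using sub fin by (intro card_inj_on_le finite_UnI finite_cartesian_product)
  also have "\<dots> \<le> card (?C True \<times> ?C False) + card (?C False \<times> ?C True)" by (rule card_Un_le)
  also have "\<dots> = 2 * (card (?C True) * card (?C False))"
    by (simp only: card_cartesian_product mult.commute mult_2)
  also have "\<dots> \<le> 2 * (3 * 3)"
    by (intro mult_le_mono col_bag t(1) order_refl)
  finally have "card (parcs H) \<le> 18" by simp
  moreover have "card (parcs H) = 20"
  proof -
    have "parcs H = pverts H \<times> pverts H - (\<lambda>x. (x, x)) ` pverts H" using H(3) by auto
    moreover have "card ((\<lambda>x. (x, x)) ` pverts H) = 5"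
      using H by (subst card_image) (auto intro: inj_onI)
    moreover have "(\<lambda>x. (x, x)) ` pverts H \<subseteq> pverts H \<times> pverts H" by auto
    ultimately show ?thesis
      using H(1,2) by (simp add: card_Diff_subset card_cartesian_product)
  qed
  ultimately show False by simp
qed

end

section \<open>Orthogonal families of sets\<close>

lemma even_card_involution:
  assumes "finite S" "\<And>x. x \<in> S \<Longrightarrow> f x \<in> S \<and> f (f x) = x \<and> f x \<noteq> x"
  shows "even (card S)"
  using assms
proof (induction "card S" arbitrary: S rule: less_induct)
  case less
  show ?case
  proof (cases "S = {}")
    case False
    then obtain x where x: "x \<in> S" by blast
    let ?S = "S - {x, f x}"
    have fx: "f x \<in> S" "f (f x) = x" "f x \<noteq> x" using less.prems x by blast+
    then have card: "card S = card ?S + 2"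
      using less.prems(1) x card_Diff_subset[of "{x, f x}" S] card_mono[of S "{x, f x}"] by simp
    have "even (card ?S)"
    proof (rule less.hyps)
      show "f y \<in> ?S \<and> f (f y) = y \<and> f y \<noteq> y" if "y \<in> ?S" for y
        using that less.prems(2)[of y] fx by (metis Diff_iff insert_iff empty_iff)
    qed (use card less.prems(1) in auto)
    then show ?thesis using card by simp
  qed simp
qed

lemma sum_prod_signs:
  fixes h :: "'a \<Rightarrow> int"
  assumes "finite E"
  shows "(\<Sum>X\<in>Pow E. \<Prod>x\<in>X. h x) = (\<Prod>x\<in>E. h x + 1)"
  by (simp add: prod_add[OF assms])

text \<open>This is \<open>dim A + dim B \<le> card E\<close> for orthogonal subspaces over the two-element field, but the
  argument (Parseval's identity for the characters indexed by \<open>A\<close>) does not need subspaces.\<close>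

lemma card_orthogonal_families:
  assumes "finite E" "A \<subseteq> Pow E" "B \<subseteq> Pow E"
    and "\<And>a b. a \<in> A \<Longrightarrow> b \<in> B \<Longrightarrow> even (card (a \<inter> b))"
  shows "card A * card B \<le> 2 ^ card E"
proof (cases "A = {}")
  case False
  have finA: "finite A" using assms(1,2) finite_subset by blast
  \<comment> \<open>The product of \<open>s a x\<close> over \<open>x \<in> X\<close> is
    \<open>(-1) ^ card (a \<inter> X)\<close>, the character indexed by \<open>a\<close>.
    Orthogonality makes every character equal to 1 on \<open>B\<close>, so their sum
    \<open>g\<close> is \<open>card A\<close> there.\<close>
  define s :: "'a set \<Rightarrow> 'a \<Rightarrow> int" where "s a x = (if x \<in> a then -1 else 1)" for a x
  define g where "g X = (\<Sum>a\<in>A. \<Prod>x\<in>X. s a x)" for X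
  have gB: "g b = int (card A)" if "b \<in> B" for b
  proof -
    have "finite b" using that assms(1,3) finite_subset by blast
    have "(\<Prod>x\<in>b. s a x) = 1" if "a \<in> A" for a
    proof -
      have "(\<Prod>x\<in>b. s a x) = (-1) ^ card (b \<inter> a)"
        unfolding s_def using \<open>finite b\<close> by (simp add: prod.If_cases)
      then show ?thesis using assms(4)[OF that \<open>b \<in> B\<close>] by (simp add: Int_commute)
    qed
    then show ?thesis by (simp add: g_def)
  qed
  have orth: "(\<Sum>X\<in>Pow E. \<Prod>x\<in>X. s a x * s a' x) = (if a = a' then 2 ^ card E else 0)"
    if "a \<in> A" "a' \<in> A" for a a'
  proof -
    have "(\<Prod>x\<in>E. s a x * s a' x + 1) = (if a = a' then 2 ^ card E else 0)"
    proof (cases "a = a'")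
      case True
      then have "s a x * s a' x = 1" for x by (simp add: s_def)
      then show ?thesis using True by simp
    next
      case False
      moreover have "a \<subseteq> E" "a' \<subseteq> E" using that assms(2) by auto
      ultimately have "\<exists>x\<in>E. x \<in> a \<longleftrightarrow> x \<notin> a'" by blast
      then obtain x where "x \<in> E" "x \<in> a \<longleftrightarrow> x \<notin> a'" by blast
      then have "\<exists>x\<in>E. s a x * s a' x + 1 = 0" by (intro bexI[of _ x]) (auto simp: s_def)
      then show ?thesis using False assms(1) by (simp add: prod_zero)
    qed
    then show ?thesis by (simp add: sum_prod_signs[OF assms(1)])
  qed
  \<comment> \<open>Restricting the nonnegative sum of squares of \<open>g\<close> to
    \<open>B\<close> gives a lower bound; the orthogonality of the characters evaluates the full
    sum.\<close>
  have "int (card B) * (int (card A) * int (card A)) = (\<Sum>X\<in>B. g X * g X)"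
    by (simp add: gB)
  also have "\<dots> \<le> (\<Sum>X\<in>Pow E. g X * g X)"
    using assms(1,3) by (intro sum_mono2) auto
  also have "\<dots> = (\<Sum>X\<in>Pow E. \<Sum>a\<in>A. \<Sum>a'\<in>A. \<Prod>x\<in>X. s a x * s a' x)"
    by (simp add: g_def sum_product prod.distrib)
  also have "\<dots> = (\<Sum>a\<in>A. \<Sum>a'\<in>A. \<Sum>X\<in>Pow E. \<Prod>x\<in>X. s a x * s a' x)"
    by (subst sum.swap, rule sum.cong[OF refl], rule sum.swap)
  also have "\<dots> = (\<Sum>a\<in>A. \<Sum>a'\<in>A. if a = a' then 2 ^ card E else 0)"
    by (intro sum.cong refl orth)
  also have "\<dots> = int (card A) * 2 ^ card E"
    using finA by simp
  finally have "int (card A) * int (card A * card B) \<le> int (card A) * 2 ^ card E"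
    by (simp add: mult_ac)
  moreover have "int (card A) > 0" using False finA by (simp add: card_gt_0_iff)
  ultimately have "int (card A * card B) \<le> 2 ^ card E" by (simp only: mult_le_cancel_left_pos)
  then show ?thesis by (metis of_nat_le_iff of_nat_numeral of_nat_power)
qed simp

section \<open>Facial walks\<close>

text \<open>Meant for \<open>face_step\<close>, whose injectivity is established only on the states
  of the graph: cutting \<open>f\<close> down to \<open>S\<close> gives a permutation with the same
  orbits in \<open>S\<close>.\<close>

lemma self_in_orbit_finite:
  assumes "finite S" "f ` S \<subseteq> S" "inj_on f S" "x \<in> S"
  shows "x \<in> orbit f x"
proof -
  let ?g = "perm_restrict f S"
  have "bij_betw f S S"
    using assms by (simp add: bij_betw_def endo_inj_surj)
  then have "bij_betw ?g S S"
    by (rule bij_betw_cong[THEN iffD1, rotated]) (simp add: perm_restrict_def)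
  then have "?g permutes S"
    by (rule bij_imp_permutes) (simp add: perm_restrict_def)
  then have "permutation ?g"
    unfolding permutation_permutes using assms(1) by (intro exI[of _ S] conjI)
  then have "x \<in> orbit ?g x" by (rule permutation_self_in_orbit)
  moreover have "orbit f x = orbit ?g x"
  proof (rule orbit_cong0[OF assms(4)])
    show "f \<in> S \<rightarrow> S" using assms(2) by blast
  qed (simp add: perm_restrict_def)
  ultimately show ?thesis by simp
qed

lemma orbit_closed:
  assumes "x \<in> S" "\<And>y. y \<in> S \<Longrightarrow> f y \<in> S"
  shows "orbit f x \<subseteq> S"
proof
  fix y assume "y \<in> orbit f x"
  then show "y \<in> S" by induction (use assms in auto)
qed

locale scheme = pair_graph G for G :: "'a pair_pre_digraph" +
  fixes rot :: "'a \<times> 'a \<Rightarrow> 'a \<times> 'a" and tw :: "'a \<times> 'a \<Rightarrow> bool"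
  assumes scheme: "embedding_scheme G rot tw"
begin

lemma fin_arcs: "finite (parcs G)" and fin_verts: "finite (pverts G)"
  using pair_finite_arcs pair_finite_verts by auto

lemma arc_verts: "(u, v) \<in> parcs G \<Longrightarrow> u \<in> pverts G \<and> v \<in> pverts G"
  using in_arcsD1 in_arcsD2 by blast

lemma swap_arc: "(v, u) \<in> parcs G" if "(u, v) \<in> parcs G"
  using sym_arcs that by (auto simp: symmetric_def dest: symD)

lemma swap_in: "e \<in> parcs G \<Longrightarrow> prod.swap e \<in> parcs G"
  using swap_arc by (cases e) simp

lemma rot_permutes: "rot permutes parcs G"
  using scheme by (simp add: embedding_scheme_def)

lemma tw_swap: "e \<in> parcs G \<Longrightarrow> tw (prod.swap e) = tw e"
  using scheme by (simp add: embedding_scheme_def)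

abbreviation "out v \<equiv> {e \<in> parcs G. fst e = v}"

lemma cyclic_out: "v \<in> pverts G \<Longrightarrow> out v \<noteq> {} \<Longrightarrow> cyclic_on rot (out v)"
  using scheme by (auto simp: embedding_scheme_def out_arcs_def)

lemma rot_in: "e \<in> parcs G \<Longrightarrow> rot e \<in> parcs G"
  using rot_permutes by (simp add: permutes_in_image)

lemma fst_rot: "e \<in> parcs G \<Longrightarrow> fst (rot e) = fst e"
proof -
  assume e: "e \<in> parcs G"
  then have "e \<in> out (fst e)" by simp
  then have "cyclic_on rot (out (fst e))"
    using cyclic_out[of "fst e"] arc_fst_in_verts[OF e] by blast
  then have "rot e \<in> out (fst e)" by (rule cyclic_on_inI) (use e in simp)
  then show ?thesis by simp
qed

lemma inv_rot_in: "e \<in> parcs G \<Longrightarrow> inv rot e \<in> parcs G"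
  using permutes_inv[OF rot_permutes] by (simp add: permutes_in_image)

lemma rot_inv_rot: "rot (inv rot e) = e" and inv_rot_rot: "inv rot (rot e) = e"
  using permutes_inverses[OF rot_permutes] by auto

lemma fst_inv_rot: "e \<in> parcs G \<Longrightarrow> fst (inv rot e) = fst e"
  using fst_rot[OF inv_rot_in, of e] by (simp add: rot_inv_rot)

definition states :: "'a set \<Rightarrow> (('a \<times> 'a) \<times> bool) set" where
  "states C = {(e, b). e \<in> parcs G \<and> fst e \<in> C}"

abbreviation "step \<equiv> face_step rot tw"
abbreviation "mirror \<equiv> face_reverse tw"

text \<open>\<open>corner\<close> passes to the opposite state at the same corner of the surface, so a face is a class
  of the equivalence relation generated by the involutions \<open>corner\<close> and \<open>mirror\<close>.\<close>

fun corner :: "('a \<times> 'a) \<times> bool \<Rightarrow> ('a \<times> 'a) \<times> bool" where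
  "corner (e, b) = (if b then (inv rot e, False) else (rot e, True))"

lemma corner_corner: "corner (corner x) = x"
  by (cases x) (simp add: rot_inv_rot inv_rot_rot)

lemma step_eq: "step x = corner (mirror x)"
  by (cases x) (simp add: Let_def)

text \<open>Since arcs are symmetric, these are the unions of connected components. States and faces
  are restricted to such sets so that components can be counted one by one.\<close>

definition "arc_closed C \<longleftrightarrow> C \<subseteq> pverts G \<and> (\<forall>(u, v)\<in>parcs G. u \<in> C \<longrightarrow> v \<in> C)"

lemma arc_closedD: "arc_closed C \<Longrightarrow> (u, v) \<in> parcs G \<Longrightarrow> u \<in> C \<Longrightarrow> v \<in> C"
  by (auto simp: arc_closed_def)

lemma closed_verts: "arc_closed (pverts G)"
  using arc_verts by (auto simp: arc_closed_def)

lemma states_sub: "C \<subseteq> D \<Longrightarrow> states C \<subseteq> states D"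
  by (auto simp: states_def)

lemma states_verts: "states (pverts G) = parcs G \<times> UNIV"
  using arc_verts by (auto simp: states_def)

lemma mirror_mirror: "x \<in> states C \<Longrightarrow> mirror (mirror x) = x"
  by (cases x) (auto simp: states_def tw_swap)

lemma corner_in: "x \<in> states C \<Longrightarrow> corner x \<in> states C"
  by (cases x) (auto simp: states_def rot_in inv_rot_in fst_rot fst_inv_rot)

lemma mirror_in: "arc_closed C \<Longrightarrow> x \<in> states C \<Longrightarrow> mirror x \<in> states C"
  by (cases x) (auto simp: states_def swap_in dest: arc_closedD)

lemma step_in: "arc_closed C \<Longrightarrow> x \<in> states C \<Longrightarrow> step x \<in> states C"
  by (simp add: step_eq corner_in mirror_in)

lemma fin_states: "finite (states C)"
proof -
  have "states C \<subseteq> parcs G \<times> UNIV" by (auto simp: states_def)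
  then show ?thesis by (rule finite_subset) (simp add: fin_arcs)
qed

text \<open>As a product of two involutions, \<open>step\<close> is turned into its inverse by
  conjugation with \<open>mirror\<close>.\<close>

lemma step_mirror_step:
  assumes "x \<in> states (pverts G)"
  shows "step (mirror (step x)) = mirror x"
proof -
  have "mirror (mirror (step x)) = step x"
    using mirror_mirror step_in[OF closed_verts assms] by blast
  then show ?thesis using step_eq[of "mirror (step x)"] step_eq[of x] corner_corner by metis
qed

lemma self_in_orbit:
  assumes "x \<in> states (pverts G)"
  shows "x \<in> orbit step x"
proof (rule self_in_orbit_finite[OF fin_states _ _ assms])
  show "step ` states (pverts G) \<subseteq> states (pverts G)"
    using step_in[OF closed_verts] by blast
  show "inj_on step (states (pverts G))"
    by (metis inj_onI mirror_mirror step_mirror_step)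
qed

lemma mirror_orbit:
  assumes "x \<in> states (pverts G)" "y \<in> orbit step x"
  shows "mirror y \<in> orbit step (mirror x)"
proof -
  \<comment> \<open>\<open>mirror (step z)\<close> is the predecessor of \<open>mirror z\<close>; on
    a finite orbit a predecessor is also reached by going forward.\<close>
  have undo: "mirror (step z) \<in> orbit step (mirror z)" if "z \<in> states (pverts G)" for z
  proof -
    let ?w = "mirror (step z)"
    have "?w \<in> states (pverts G)"
      using that step_in mirror_in closed_verts by blast
    then have "?w \<in> orbit step ?w" by (rule self_in_orbit)
    then show ?thesis using self_in_orbit_step[of ?w step] step_mirror_step[OF that] by simp
  qed
  have "y \<in> states (pverts G) \<and> mirror y \<in> orbit step (mirror x)"
    using assms(2)
  proof induction
    case base
    then show ?case using undo assms(1) step_in closed_verts by blast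
  next
    case (step y)
    then show ?case using undo[of y] step_in[OF closed_verts] orbit_trans by metis
  qed
  then show ?thesis ..
qed

definition "face x = orbit step x \<union> orbit step (mirror x)"

definition "faces C = face ` states C"

lemma facial_walks_eq: "facial_walks G rot tw = faces (pverts G)"
  by (simp add: facial_walks_def faces_def face_def[abs_def] states_verts)

lemma face_self: "x \<in> states (pverts G) \<Longrightarrow> x \<in> face x"
  by (simp add: face_def self_in_orbit)

lemma face_sub:
  assumes "x \<in> S" "mirror x \<in> S" "\<And>y. y \<in> S \<Longrightarrow> step y \<in> S"
  shows "face x \<subseteq> S"
  using assms orbit_closed[of _ S step] unfolding face_def by blast

lemma face_states: "arc_closed C \<Longrightarrow> x \<in> states C \<Longrightarrow> face x \<subseteq> states C"
  by (intro face_sub step_in mirror_in)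

lemma face_mirror:
  assumes "x \<in> states (pverts G)" "y \<in> face x"
  shows "mirror y \<in> face x"
proof -
  have "mirror x \<in> states (pverts G)" "mirror (mirror x) = x"
    using assms(1) mirror_in[OF closed_verts] mirror_mirror by blast+
  then show ?thesis
    using assms mirror_orbit[of x y] mirror_orbit[of "mirror x" y] unfolding face_def by auto
qed

lemma face_stepI: "y \<in> face x \<Longrightarrow> step y \<in> face x"
  by (auto simp: face_def intro: orbit.step)

lemma face_corner:
  assumes "x \<in> states (pverts G)" "y \<in> face x"
  shows "corner y \<in> face x"
proof -
  have "y \<in> states (pverts G)" using face_states[OF closed_verts] assms by blast
  then have "corner y = step (mirror y)" by (simp add: step_eq mirror_mirror)
  then show ?thesis using face_stepI face_mirror assms by metis
qed

lemma face_eq: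
  assumes "x \<in> states (pverts G)" "y \<in> face x"
  shows "face y = face x"
proof -
  have y: "y \<in> states (pverts G)" using face_states[OF closed_verts] assms by blast
  have rx: "mirror x \<in> states (pverts G)" "mirror (mirror x) = x"
    using assms(1) mirror_in[OF closed_verts] mirror_mirror by blast+
  have "x \<in> face y"
  proof (cases "y \<in> orbit step x")
    case True
    then show ?thesis using orbit_swap self_in_orbit assms(1) unfolding face_def by fast
  next
    case False
    then have "y \<in> orbit step (mirror x)" using assms(2) by (simp add: face_def)
    then have "mirror x \<in> face y" using orbit_swap self_in_orbit rx(1) unfolding face_def by fast
    then show ?thesis using face_mirror[OF y] rx(2) by metis
  qed
  then have "face x \<subseteq> face y" using face_sub face_mirror y face_stepI by metis
  moreover have "face y \<subseteq> face x" using face_sub face_mirror assms face_stepI by metis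
  ultimately show ?thesis by blast
qed

lemma faces_disjoint:
  assumes "f \<in> faces (pverts G)" "g \<in> faces (pverts G)" "x \<in> f" "x \<in> g"
  shows "f = g"
  using assms face_eq unfolding faces_def by blast

lemma fin_faces: "finite (faces C)"
  by (simp add: faces_def fin_states)

end

section \<open>Euler's inequality\<close>

context scheme
begin

definition component :: "'a set \<Rightarrow> bool" where
  "component C \<longleftrightarrow> arc_closed C \<and> C \<noteq> {} \<and> (\<forall>u\<in>C. \<forall>v\<in>C. (u, v) \<in> (parcs G)\<^sup>*)"

lemma fin_arc_closed: "arc_closed C \<Longrightarrow> finite C"
  using fin_verts finite_subset by (auto simp only: arc_closed_def)

definition arcs_in :: "'a set \<Rightarrow> ('a \<times> 'a) set" where
  "arcs_in C = {e \<in> parcs G. fst e \<in> C}"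

definition edges :: "'a set \<Rightarrow> 'a set set" where
  "edges C = (\<lambda>(u, v). {u, v}) ` arcs_in C"

lemma fin_arcs_in: "finite (arcs_in C)"
  using fin_arcs by (simp add: arcs_in_def)

lemma fin_edges: "finite (edges C)"
  by (simp add: edges_def fin_arcs_in)

lemma arc_neq: "(u, v) \<in> parcs G \<Longrightarrow> u \<noteq> v"
  using pair_no_loops by fastforce

lemma in_states: "(e, b) \<in> states C \<longleftrightarrow> e \<in> arcs_in C"
  by (simp add: states_def arcs_in_def)

lemma arcs_in_swap: "arc_closed C \<Longrightarrow> e \<in> arcs_in C \<Longrightarrow> prod.swap e \<in> arcs_in C"
  by (cases e) (auto simp: arcs_in_def swap_in dest: arc_closedD intro: swap_arc)

lemma arcs_in_rot: "e \<in> arcs_in C \<Longrightarrow> rot e \<in> arcs_in C"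
  by (simp add: arcs_in_def rot_in fst_rot)

text \<open>A local description of the unions of faces, chosen because it passes directly to
  symmetric differences.\<close>

definition saturated :: "'a set \<Rightarrow> (('a \<times> 'a) \<times> bool) set \<Rightarrow> bool" where
  "saturated C U \<longleftrightarrow> U \<subseteq> states C \<and> (\<forall>x\<in>U. mirror x \<in> U \<and> corner x \<in> U)"

lemma saturated_iff:
  assumes "saturated C U" "arc_closed C" "e \<in> arcs_in C"
  shows "(e, False) \<in> U \<longleftrightarrow> (rot e, True) \<in> U"
    and "(e, b) \<in> U \<longleftrightarrow> (prod.swap e, \<not> (b \<noteq> tw e)) \<in> U"
proof -
  have "corner (e, False) = (rot e, True)" "corner (rot e, True) = (e, False)"
    by (simp_all add: inv_rot_rot)
  then show "(e, False) \<in> U \<longleftrightarrow> (rot e, True) \<in> U"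
    using assms(1) unfolding saturated_def by metis
  have "mirror (e, b) = (prod.swap e, \<not> (b \<noteq> tw e))" by simp
  moreover have "mirror (mirror (e, b)) = (e, b)"
    using assms(3) by (intro mirror_mirror) (simp add: in_states)
  ultimately show "(e, b) \<in> U \<longleftrightarrow> (prod.swap e, \<not> (b \<noteq> tw e)) \<in> U"
    using assms(1) unfolding saturated_def by metis
qed

lemma saturated_Union_faces:
  assumes "arc_closed C" "S \<subseteq> faces C"
  shows "saturated C (\<Union>S)"
  unfolding saturated_def
proof (intro conjI ballI)
  have sub: "states C \<subseteq> states (pverts G)"
    using assms(1) by (intro states_sub) (simp add: arc_closed_def)
  have f: "\<exists>x\<in>states (pverts G). f = face x" "f \<subseteq> states C" if f: "f \<in> S" for f
  proof -
    obtain x where "x \<in> states C" "f = face x" using f assms(2) unfolding faces_def by blast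
    then show "\<exists>x\<in>states (pverts G). f = face x" "f \<subseteq> states C"
      using sub face_states[OF assms(1)] by blast+
  qed
  show "\<Union>S \<subseteq> states C" using f(2) by blast
  show "mirror y \<in> \<Union>S" "corner y \<in> \<Union>S" if "y \<in> \<Union>S" for y
    using that f(1) face_mirror face_corner by blast+
qed

lemma saturated_sym_diff:
  assumes "saturated C U" "saturated C U'"
  shows "saturated C (U - U' \<union> (U' - U))"
proof -
  have "mirror x \<in> V - V'" "corner x \<in> V - V'"
    if V: "saturated C V" "saturated C V'" and x: "x \<in> V - V'" for V V' x
  proof -
    have s: "x \<in> states C" using x V(1) by (auto simp: saturated_def)
    then have "mirror (mirror x) = x" by (rule mirror_mirror)
    then show "mirror x \<in> V - V'" using V x unfolding saturated_def by (metis Diff_iff)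
    show "corner x \<in> V - V'" using V x corner_corner unfolding saturated_def by (metis Diff_iff)
  qed
  then have "\<forall>x\<in>U - U' \<union> (U' - U). mirror x \<in> U - U' \<union> (U' - U) \<and> corner x \<in> U - U' \<union> (U' - U)"
    using assms by blast
  moreover have "U - U' \<union> (U' - U) \<subseteq> states C" using assms unfolding saturated_def by blast
  ultimately show ?thesis unfolding saturated_def by blast
qed

text \<open>When both sides of every edge are in \<open>W\<close> or neither is, membership depends
  only on the arc. It is then preserved by rotation at a vertex and by reversal of an arc, so it
  spreads over the whole component.\<close>

lemma saturated_flat:
  assumes C: "component C" and W: "saturated C W"
    and flat: "\<And>e. e \<in> arcs_in C \<Longrightarrow> (e, True) \<in> W \<longleftrightarrow> (e, False) \<in> W"
    and ne: "W \<noteq> {}"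
  shows "W = states C"
proof -
  define P where "P e \<longleftrightarrow> (e, True) \<in> W" for e
  have cl: "arc_closed C" using C by (simp add: component_def)
  have P: "P e" if "(e, b) \<in> W" for e b
  proof -
    have "e \<in> arcs_in C" using that W by (auto simp: saturated_def in_states)
    then show ?thesis using that flat by (cases b) (auto simp: P_def)
  qed
  have rot: "P (rot e)" if "P e" "e \<in> arcs_in C" for e
    using that flat saturated_iff(1)[OF W cl] by (simp add: P_def)
  have swap: "P (prod.swap e)" if "P e" "e \<in> arcs_in C" for e
    using that saturated_iff(2)[OF W cl that(2), of True] P by (simp add: P_def)
  have out: "P e'" if "P e" "e \<in> arcs_in C" "e' \<in> out (fst e)" for e e'
  proof -
    have "e \<in> out (fst e)" "fst e \<in> pverts G"
      using that(2) arc_fst_in_verts by (auto simp: arcs_in_def)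
    then have "cyclic_on rot (out (fst e))" using cyclic_out by blast
    then have "e' \<in> orbit rot e" using \<open>e \<in> out (fst e)\<close> that(3) unfolding cyclic_on_alldef by blast
    then have "P e' \<and> e' \<in> arcs_in C"
      by induction (use rot arcs_in_rot that in auto)
    then show ?thesis ..
  qed
  obtain e1 b1 where "(e1, b1) \<in> W" using ne by auto
  then have e1: "P e1" "e1 \<in> arcs_in C" using P W by (auto simp: saturated_def in_states)
  have all: "P e" if "(fst e1, v) \<in> (parcs G)\<^sup>*" "e \<in> out v" for v e
  proof -
    have "v \<in> C \<and> (\<forall>e\<in>out v. P e)"
      using that(1)
    proof (induction rule: rtrancl_induct)
      case base
      then show ?case using out[OF e1] e1(2) by (auto simp: arcs_in_def)
    next
      case (step v w)
      then have vw: "(v, w) \<in> arcs_in C" "P (v, w)" by (auto simp: arcs_in_def)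
      then have "P (w, v)" "(w, v) \<in> arcs_in C" using swap[of "(v, w)"] arcs_in_swap[OF cl vw(1)] by auto
      then show ?case using out[of "(w, v)"] arc_closedD[OF cl step(2)] step(3) by auto
    qed
    then show ?thesis using that(2) by blast
  qed
  have "(e, b) \<in> W" if "e \<in> arcs_in C" for e b
  proof -
    have "(fst e1, fst e) \<in> (parcs G)\<^sup>*"
      using that e1 C by (auto simp: component_def arcs_in_def)
    then have "P e" using all[of "fst e" e] that by (auto simp: arcs_in_def)
    then show ?thesis using flat[OF that] by (cases b) (auto simp: P_def)
  qed
  then have "states C \<subseteq> W" by (auto simp: states_def arcs_in_def)
  then show ?thesis using W unfolding saturated_def by blast
qed

text \<open>\<open>(e, True)\<close> and \<open>(e, False)\<close> stand for the two sides of the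
  edge, so \<open>bd\<close> below is the boundary modulo 2: an edge with both sides in
  \<open>U\<close> cancels. Parity ignores orientation, which covers twisted schemes.\<close>

definition sep :: "(('a \<times> 'a) \<times> bool) set \<Rightarrow> 'a \<times> 'a \<Rightarrow> bool" where
  "sep U e \<longleftrightarrow> ((e, True) \<in> U) \<noteq> ((e, False) \<in> U)"

definition bd :: "'a set \<Rightarrow> (('a \<times> 'a) \<times> bool) set \<Rightarrow> 'a set set" where
  "bd C U = (\<lambda>(u, v). {u, v}) ` {e \<in> arcs_in C. sep U e}"

definition cut :: "'a set \<Rightarrow> 'a set \<Rightarrow> 'a set set" where
  "cut C A = (\<lambda>(u, v). {u, v}) ` {e \<in> arcs_in C. fst e \<in> A \<and> snd e \<notin> A}"

lemma cut_sub: "cut C A \<subseteq> edges C" and bd_sub: "bd C U \<subseteq> edges C"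
  unfolding cut_def bd_def edges_def by blast+

lemma sep_swap:
  assumes "saturated C U" "arc_closed C" "e \<in> arcs_in C"
  shows "sep U (prod.swap e) \<longleftrightarrow> sep U e"
proof (cases "tw e")
  case True
  then show ?thesis
    using saturated_iff(2)[OF assms, of True] saturated_iff(2)[OF assms, of False]
    by (simp add: sep_def)
next
  case False
  then show ?thesis
    using saturated_iff(2)[OF assms, of True] saturated_iff(2)[OF assms, of False]
    by (auto simp: sep_def)
qed

lemma in_bd:
  assumes "saturated C U" "arc_closed C" "(u, v) \<in> arcs_in C"
  shows "{u, v} \<in> bd C U \<longleftrightarrow> sep U (u, v)"
proof
  assume "{u, v} \<in> bd C U"
  then obtain a b where ab: "(a, b) \<in> arcs_in C" "sep U (a, b)" "{u, v} = {a, b}"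
    by (auto simp: bd_def)
  then have "(u, v) = (a, b) \<or> (u, v) = prod.swap (a, b)" by (auto simp: doubleton_eq_iff)
  then show "sep U (u, v)" using ab(2) sep_swap[OF assms(1,2) ab(1)] by auto
qed (use assms in \<open>auto simp: bd_def\<close>)

lemma in_cut:
  assumes "arc_closed C" "(u, v) \<in> arcs_in C"
  shows "{u, v} \<in> cut C A \<longleftrightarrow> (u \<in> A) \<noteq> (v \<in> A)"
proof
  assume "{u, v} \<in> cut C A"
  then obtain a b where "a \<in> A" "b \<notin> A" "{u, v} = {a, b}"
    by (auto simp: cut_def)
  then show "(u \<in> A) \<noteq> (v \<in> A)" by (auto simp: doubleton_eq_iff)
next
  assume "(u \<in> A) \<noteq> (v \<in> A)"
  moreover have "(v, u) \<in> arcs_in C" using arcs_in_swap[OF assms] by simp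
  ultimately show "{u, v} \<in> cut C A"
    using assms(2) unfolding cut_def by (cases "u \<in> A") (force simp: insert_commute)+
qed

text \<open>In one turn around \<open>v\<close>, the corners enter and leave \<open>U\<close> an
  even number of times, and the edges where this happens are the ones in the boundary.\<close>

lemma even_sep_out:
  assumes "saturated C U" "arc_closed C" "v \<in> C"
  shows "even (card {e \<in> out v. sep U e})"
proof -
  define X where "X = {e \<in> out v. (e, True) \<in> U}"
  \<comment> \<open>\<open>(rot e, True)\<close> is the same corner as \<open>(e, False)\<close>, so
    \<open>X\<close> and \<open>Y\<close> record the two sides of \<open>e\<close>, and
    \<open>rot\<close> maps \<open>Y\<close> onto \<open>X\<close>.\<close>
  define Y where "Y = {e \<in> out v. (rot e, True) \<in> U}"
  have fin: "finite X" "finite Y" using fin_arcs by (simp_all add: X_def Y_def)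
  have sub: "out v \<subseteq> arcs_in C" using assms(3) by (auto simp: arcs_in_def)
  have "rot ` Y = X"
  proof
    show "rot ` Y \<subseteq> X" by (auto simp: X_def Y_def rot_in fst_rot)
    show "X \<subseteq> rot ` Y"
    proof
      fix e assume "e \<in> X"
      then have "inv rot e \<in> Y" "e = rot (inv rot e)"
        by (auto simp: X_def Y_def inv_rot_in fst_inv_rot rot_inv_rot)
      then show "e \<in> rot ` Y" by blast
    qed
  qed
  moreover have "inj_on rot Y" by (metis inj_onI inv_rot_rot)
  ultimately have "card X = card Y" using card_image by metis
  moreover have "{e \<in> out v. sep U e} = (X - Y) \<union> (Y - X)"
    using saturated_iff(1)[OF assms(1,2)] sub by (auto simp: X_def Y_def sep_def)
  then have "card {e \<in> out v. sep U e} = card (X - Y) + card (Y - X)"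
    using fin card_Un_disjoint[of "X - Y" "Y - X"] by auto
  moreover have "card X = card (X \<inter> Y) + card (X - Y)" "card Y = card (X \<inter> Y) + card (Y - X)"
    using fin card_Int_Diff[of X Y] card_Int_Diff[of Y X] by (simp_all add: Int_commute)
  ultimately show ?thesis by (metis add_left_cancel even_add)
qed

text \<open>Summing the even boundary degrees over the vertices of \<open>A\<close> counts a
  boundary edge once if it leaves \<open>A\<close> and twice if it stays inside.\<close>

lemma even_cut_bd:
  assumes "saturated C U" "arc_closed C" "A \<subseteq> C"
  shows "even (card (cut C A \<inter> bd C U))"
proof -
  let ?h = "\<lambda>(u, v). {u, v}"
  define Q where "Q = {e \<in> arcs_in C. fst e \<in> A \<and> snd e \<notin> A \<and> sep U e}"
  define R where "R = {e \<in> arcs_in C. fst e \<in> A \<and> sep U e}"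
  define I where "I = {e \<in> arcs_in C. fst e \<in> A \<and> snd e \<in> A \<and> sep U e}"
  have fin: "finite Q" "finite I" "finite A"
    using fin_arcs_in fin_arc_closed[OF assms(2)] assms(3) finite_subset
    by (simp_all add: Q_def I_def)
  have "cut C A \<inter> bd C U = ?h ` Q"
  proof
    show "cut C A \<inter> bd C U \<subseteq> ?h ` Q"
    proof
      fix E assume E: "E \<in> cut C A \<inter> bd C U"
      then obtain u v where uv: "(u, v) \<in> arcs_in C" "u \<in> A" "v \<notin> A" "E = {u, v}"
        by (auto simp: cut_def)
      then have "sep U (u, v)" using in_bd[OF assms(1,2) uv(1)] E by simp
      then show "E \<in> ?h ` Q" using uv by (force simp: Q_def)
    qed
    show "?h ` Q \<subseteq> cut C A \<inter> bd C U" by (force simp: Q_def cut_def bd_def)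
  qed
  moreover have "inj_on ?h Q"
    by (auto simp: inj_on_def Q_def doubleton_eq_iff)
  ultimately have card: "card (cut C A \<inter> bd C U) = card Q" by (simp add: card_image)
  have "R = (\<Union>v\<in>A. {e \<in> out v. sep U e})"
    using assms(3) by (auto simp: R_def arcs_in_def)
  then have "card R = (\<Sum>v\<in>A. card {e \<in> out v. sep U e})"
    using fin(3) fin_arcs by (simp add: card_UN_disjoint disjoint_iff)
  then have "even (card R)"
    using even_sep_out[OF assms(1,2)] assms(3) by (auto intro!: dvd_sum)
  moreover have "R = Q \<union> I" "Q \<inter> I = {}" by (auto simp: R_def Q_def I_def)
  moreover have "even (card I)"
  proof (rule even_card_involution[OF fin(2)])
    show "prod.swap e \<in> I \<and> prod.swap (prod.swap e) = e \<and> prod.swap e \<noteq> e" if "e \<in> I" for e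
    proof (cases e)
      case (Pair u v)
      then have uv: "(u, v) \<in> arcs_in C" "u \<in> A" "v \<in> A" "sep U (u, v)"
        using that by (auto simp: I_def)
      then have "u \<noteq> v" using arc_neq by (auto simp: arcs_in_def)
      then show ?thesis
        using Pair uv arcs_in_swap[OF assms(2) uv(1)] sep_swap[OF assms(1,2) uv(1)]
        by (simp add: I_def)
    qed
  qed
  ultimately have "even (card Q)" using fin by (simp add: card_Un_disjoint)
  then show ?thesis using card by simp
qed

text \<open>Leaving out one vertex makes the subsets of \<open>C\<close> have distinct cuts, and
  leaving out one face makes the sets of faces have distinct boundaries. The bound for orthogonal
  families then compares the exponents |C| - 1 and |F| - 1 with the number of edges.\<close>

theorem euler_inequality:
  assumes C: "component C"
  shows "card C + card (faces C) \<le> card (edges C) + 2"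
proof -
  have cl: "arc_closed C" using C by (simp add: component_def)
  have finC: "finite C" using cl by (rule fin_arc_closed)
  obtain c0 where c0: "c0 \<in> C" using C by (auto simp: component_def)
  \<comment> \<open>For a component without arcs there is no face, and \<open>f0\<close> is an
    arbitrary value whose removal changes nothing.\<close>
  define f0 where "f0 = (SOME f. f \<in> faces C)"
  let ?VV = "Pow (C - {c0})" and ?FF = "Pow (faces C - {f0})"
  have sat: "saturated C (\<Union>S)" if "S \<in> ?FF" for S
    using that saturated_Union_faces[OF cl] by blast
  have inj_cut: "inj_on (cut C) ?VV"
  proof (rule inj_onI)
    fix A B assume A: "A \<in> ?VV" "B \<in> ?VV" and eq: "cut C A = cut C B"
    \<comment> \<open>Both sets omit \<open>c0\<close>, and equal cuts force them to change
      membership along the same arcs of a walk from \<open>c0\<close>.\<close>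
    have "v \<in> C \<and> (v \<in> A \<longleftrightarrow> v \<in> B)" if "(c0, v) \<in> (parcs G)\<^sup>*" for v
      using that
    proof (induction rule: rtrancl_induct)
      case base
      then show ?case using A c0 by auto
    next
      case (step v w)
      then have "(v, w) \<in> arcs_in C" by (simp add: arcs_in_def)
      then have "((v \<in> A) \<noteq> (w \<in> A)) \<longleftrightarrow> ((v \<in> B) \<noteq> (w \<in> B))"
        using in_cut[OF cl] eq by metis
      then show ?case using step arc_closedD[OF cl] by blast
    qed
    moreover have "(c0, v) \<in> (parcs G)\<^sup>*" if "v \<in> C" for v
      using that c0 C unfolding component_def by blast
    ultimately show "A = B" using A by blast
  qed
  have inj_bd: "inj_on (\<lambda>S. bd C (\<Union>S)) ?FF"
  proof (rule inj_onI)
    fix S S' assume S: "S \<in> ?FF" "S' \<in> ?FF" and eq: "bd C (\<Union>S) = bd C (\<Union>S')"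
    have F: "faces C \<subseteq> faces (pverts G)"
      using cl states_sub unfolding faces_def arc_closed_def by blast
    have face_ne: "\<exists>x\<in>states C. x \<in> f" if "f \<in> faces C" for f
      using that face_self states_sub[of C "pverts G"] cl
      unfolding faces_def arc_closed_def by blast
    \<comment> \<open>Equal boundaries make the symmetric difference flat, hence empty or
      everything; it cannot be everything because both families omit \<open>f0\<close>.\<close>
    let ?W = "\<Union>S - \<Union>S' \<union> (\<Union>S' - \<Union>S)"
    have "?W = {}"
    proof (rule ccontr)
      assume ne: "?W \<noteq> {}"
      have "(e, True) \<in> ?W \<longleftrightarrow> (e, False) \<in> ?W" if "e \<in> arcs_in C" for e
      proof -
        obtain u v where uv: "e = (u, v)" by (cases e)
        have "sep (\<Union>S) e \<longleftrightarrow> sep (\<Union>S') e"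
          using in_bd[OF sat[OF S(1)] cl, of u v] in_bd[OF sat[OF S(2)] cl, of u v] eq that uv by simp
        then show ?thesis unfolding sep_def by blast
      qed
      then have W: "?W = states C"
        using saturated_flat[OF C saturated_sym_diff[OF sat[OF S(1)] sat[OF S(2)]]] ne by blast
      have "faces C \<noteq> {}" using ne S by blast
      then have f0: "f0 \<in> faces C" unfolding f0_def by (simp add: some_in_eq)
      then obtain x where x: "x \<in> f0" "x \<in> ?W" using face_ne W by blast
      then obtain f where "f \<in> S \<union> S'" "x \<in> f" by blast
      then show False using faces_disjoint[of f f0 x] F f0 x(1) S by blast
    qed
    then have "\<Union>S = \<Union>S'" by blast
    have "A \<subseteq> B" if "A \<in> ?FF" "B \<in> ?FF" "\<Union>A = \<Union>B" for A B
    proof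
      fix f assume f: "f \<in> A"
      then obtain x where x: "x \<in> f" using face_ne \<open>A \<in> ?FF\<close> by blast
      then obtain g where g: "g \<in> B" "x \<in> g" using f \<open>\<Union>A = \<Union>B\<close> by blast
      then have "f = g" using faces_disjoint[of f g x] F x f that by blast
      then show "f \<in> B" using g by simp
    qed
    from this[OF S] this[OF S(2,1)] \<open>\<Union>S = \<Union>S'\<close> show "S = S'" by simp
  qed
  have sub: "cut C ` ?VV \<subseteq> Pow (edges C)" "(\<lambda>S. bd C (\<Union>S)) ` ?FF \<subseteq> Pow (edges C)"
    by (intro image_subsetI PowI cut_sub bd_sub)+
  have even: "even (card (a \<inter> b))"
    if a: "a \<in> cut C ` ?VV" and b: "b \<in> (\<lambda>S. bd C (\<Union>S)) ` ?FF" for a b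
  proof -
    obtain A where A: "A \<in> ?VV" "a = cut C A" using a by (rule imageE)
    obtain S where S: "S \<in> ?FF" "b = bd C (\<Union>S)" using b by (rule imageE)
    have "A \<subseteq> C" using A(1) by blast
    then show ?thesis unfolding A(2) S(2) by (rule even_cut_bd[OF sat[OF S(1)] cl])
  qed
  have "card (cut C ` ?VV) * card ((\<lambda>S. bd C (\<Union>S)) ` ?FF) \<le> 2 ^ card (edges C)"
    by (rule card_orthogonal_families[OF fin_edges sub even])
  moreover have "card (cut C ` ?VV) = 2 ^ (card C - 1)"
    using finC c0 inj_cut by (simp add: card_image card_Pow)
  moreover have "card ((\<lambda>S. bd C (\<Union>S)) ` ?FF) = 2 ^ card (faces C - {f0})"
    using fin_faces inj_bd by (simp add: card_image card_Pow)
  ultimately have "(2::nat) ^ (card C - 1 + card (faces C - {f0})) \<le> 2 ^ card (edges C)"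
    by (simp add: power_add)
  then have "card C - 1 + card (faces C - {f0}) \<le> card (edges C)"
    by simp
  moreover have "card (faces C) \<le> card (faces C - {f0}) + 1"
    using diff_card_le_card_Diff[of "{f0}" "faces C"] by simp
  ultimately show ?thesis by linarith
qed

end

section \<open>Face counts in bipartite components and additivity of the Euler genus\<close>

context scheme
begin

lemma card_arcs_in:
  assumes "arc_closed C"
  shows "card (arcs_in C) = 2 * card (edges C)"
proof -
  let ?h = "\<lambda>(u, v). {u, v}"
  have fiber: "card {e \<in> arcs_in C. ?h e = E} = 2" if "E \<in> edges C" for E
  proof -
    from that obtain u v where uv: "(u, v) \<in> arcs_in C" "E = {u, v}" by (auto simp: edges_def)
    then have "(v, u) \<in> arcs_in C" "u \<noteq> v"
      using arcs_in_swap[OF assms uv(1)] arc_neq by (auto simp: arcs_in_def)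
    then have "{e \<in> arcs_in C. ?h e = E} = {(u, v), (v, u)}"
      using uv by (auto simp: doubleton_eq_iff)
    then show ?thesis using \<open>u \<noteq> v\<close> by simp
  qed
  have "card (arcs_in C) = (\<Sum>E\<in>edges C. card {e \<in> arcs_in C. ?h e = E})"
    unfolding card_eq_sum edges_def by (rule sum.image_gen[OF fin_arcs_in])
  also have "\<dots> = 2 * card (edges C)" using fiber by simp
  finally show ?thesis .
qed

lemma card_states: "card (states C) = 2 * card (arcs_in C)"
proof -
  have "states C = arcs_in C \<times> UNIV" by (auto simp: states_def arcs_in_def)
  then show ?thesis by (simp add: card_cartesian_product)
qed

lemma Union_faces:
  assumes "arc_closed C"
  shows "\<Union>(faces C) = states C"
proof -
  have "states C \<subseteq> states (pverts G)" using assms states_sub by (simp add: arc_closed_def)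
  then show ?thesis using face_self face_states[OF assms] unfolding faces_def by blast
qed

lemma faces_mono: "C \<subseteq> D \<Longrightarrow> faces C \<subseteq> faces D"
  using states_sub unfolding faces_def by blast

text \<open>Every edge carries four states, from two arcs and two modes, and the faces partition the
  states.\<close>

lemma sum_card_faces:
  assumes "arc_closed C"
  shows "(\<Sum>f\<in>faces C. card f) = 4 * card (edges C)"
proof -
  have "C \<subseteq> pverts G" using assms by (simp add: arc_closed_def)
  then have "faces C \<subseteq> faces (pverts G)" by (rule faces_mono)
  have "card (\<Union>(faces C)) = (\<Sum>f\<in>faces C. card f)"
  proof (rule card_Union_disjoint)
    show "disjoint (faces C)"
      using faces_disjoint \<open>faces C \<subseteq> faces (pverts G)\<close>
      unfolding disjoint_def disjnt_def pairwise_def by blast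
    show "finite f" if "f \<in> faces C" for f
    proof (rule finite_subset[OF _ fin_states])
      show "f \<subseteq> states C" using that Union_faces[OF assms] by blast
    qed
  qed
  then show ?thesis using Union_faces[OF assms] card_states card_arcs_in[OF assms] by simp
qed

text \<open>A face contains both directions of its walk, so length 4 means 8 states. Without fixed
  points of \<open>rot\<close> the walk never turns back, and the colours separate vertices at
  distance three along it; so four consecutive arcs and their reversals are all distinct, even if
  the walk closes up after four steps.\<close>

lemma card_face_bipartite:
  assumes cl: "arc_closed C" and x: "x \<in> states C"
    and col: "\<And>u v. (u, v) \<in> arcs_in C \<Longrightarrow> col u \<noteq> (col v :: bool)"
    and nofix: "\<And>e. e \<in> arcs_in C \<Longrightarrow> rot e \<noteq> e"
  shows "8 \<le> card (face x)"
proof -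
  have xG: "x \<in> states (pverts G)" using x cl states_sub by (auto simp: arc_closed_def)
  define F where "F = fst ` face x"
  have F: "e \<in> F \<Longrightarrow> prod.swap e \<in> F" for e
  proof -
    assume "e \<in> F"
    then obtain b where "(e, b) \<in> face x" by (auto simp: F_def)
    then have "mirror (e, b) \<in> face x" by (rule face_mirror[OF xG])
    then show ?thesis by (force simp: F_def)
  qed
  have next_arc: "\<exists>w b'. ((v, w), b') \<in> face x \<and> w \<noteq> u \<and> (v, w) \<in> arcs_in C"
    if uv: "((u, v), b) \<in> face x" for u v b
  proof -
    have "((u, v), b) \<in> states C" using face_states[OF cl x] uv by blast
    then have vu: "(v, u) \<in> arcs_in C" using arcs_in_swap[OF cl, of "(u, v)"] in_states by simp
    define e where "e = fst (step ((u, v), b))"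
    have e: "(e, snd (step ((u, v), b))) \<in> face x" using face_stepI[OF uv] by (simp add: e_def)
    then have eC: "e \<in> arcs_in C" using face_states[OF cl x] in_states by blast
    have "e = rot (v, u) \<or> e = inv rot (v, u)" by (simp add: e_def Let_def)
    moreover have "rot (v, u) \<noteq> (v, u)" using nofix vu by blast
    moreover from this have "inv rot (v, u) \<noteq> (v, u)" using rot_inv_rot by metis
    ultimately have "e \<noteq> (v, u)" by auto
    moreover have "fst e = v"
      using \<open>e = rot (v, u) \<or> e = inv rot (v, u)\<close> fst_rot fst_inv_rot vu by (auto simp: arcs_in_def)
    ultimately show ?thesis using e eC by (cases e) auto
  qed
  obtain a b m0 where x0: "x = ((a, b), m0)" by (cases x) auto
  have s0: "((a, b), m0) \<in> face x" "(a, b) \<in> arcs_in C"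
    using face_self[OF xG] x x0 in_states by auto
  obtain c m1 where s1: "((b, c), m1) \<in> face x" "c \<noteq> a" "(b, c) \<in> arcs_in C"
    using next_arc[OF s0(1)] by blast
  obtain d m2 where s2: "((c, d), m2) \<in> face x" "d \<noteq> b" "(c, d) \<in> arcs_in C"
    using next_arc[OF s1(1)] by blast
  obtain f m3 where s3: "((d, f), m3) \<in> face x" "f \<noteq> c" "(d, f) \<in> arcs_in C"
    using next_arc[OF s2(1)] by blast
  have cols: "col a \<noteq> col b" "col b \<noteq> col c" "col c \<noteq> col d" "col d \<noteq> col f"
    using col s0(2) s1(3) s2(3) s3(3) by blast+
  then have ne: "a \<noteq> b" "b \<noteq> c" "c \<noteq> d" "d \<noteq> f" "a \<noteq> d" "b \<noteq> f" by auto
  let ?L = "[(a, b), (b, c), (c, d), (d, f), (b, a), (c, b), (d, c), (f, d)]"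
  have "distinct ?L" using ne s1(2) s2(2) s3(2) by auto
  then have "card (set ?L) = 8" by (simp only: distinct_card list.size)
  moreover have "set ?L \<subseteq> F"
  proof -
    have "(a, b) \<in> F" "(b, c) \<in> F" "(c, d) \<in> F" "(d, f) \<in> F"
      using s0(1) s1(1) s2(1) s3(1) by (force simp: F_def)+
    then show ?thesis using F by fastforce
  qed
  moreover have "finite (face x)"
    using face_states[OF cl x] fin_states finite_subset by blast
  moreover from this have "card F \<le> card (face x)" "finite F"
    by (simp_all add: F_def card_image_le)
  ultimately show ?thesis using card_mono[of F "set ?L"] by linarith
qed

lemma card_faces_bipartite:
  assumes cl: "arc_closed C"
    and col: "\<And>u v. (u, v) \<in> arcs_in C \<Longrightarrow> col u \<noteq> (col v :: bool)"
    and nofix: "\<And>e. e \<in> arcs_in C \<Longrightarrow> rot e \<noteq> e"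
  shows "2 * card (faces C) \<le> card (edges C)"
proof -
  have "8 \<le> card f" if f: "f \<in> faces C" for f
  proof -
    obtain x where "x \<in> states C" "f = face x" using f unfolding faces_def by blast
    then show ?thesis using card_face_bipartite[OF cl, of x col] col nofix by blast
  qed
  then have "(\<Sum>f\<in>faces C. 8) \<le> (\<Sum>f\<in>faces C. card f)" by (rule sum_mono)
  then show ?thesis using sum_card_faces[OF cl] by simp
qed

lemma rot_no_fixpoint:
  assumes "(v, u) \<in> parcs G" "(v, w) \<in> parcs G" "u \<noteq> w"
  shows "rot (v, u) \<noteq> (v, u)"
proof
  assume eq: "rot (v, u) = (v, u)"
  have vu: "(v, u) \<in> out v" using assms(1) by simp
  then have "cyclic_on rot (out v)" using cyclic_out[of v] arc_verts[OF assms(1)] by blast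
  then have "out v = orbit rot (v, u)" using vu unfolding cyclic_on_alldef by blast
  moreover have "orbit rot (v, u) \<subseteq> {(v, u)}" by (rule orbit_closed) (use eq in auto)
  moreover have "(v, w) \<in> out v" using assms(2) by simp
  ultimately show False using assms(3) by auto
qed

lemma sccs_verts_components:
  assumes "\<Union>\<C> = pverts G" "\<And>C. C \<in> \<C> \<Longrightarrow> component C"
  shows "sccs_verts = \<C>"
proof -
  have reach: "u \<rightarrow>\<^sup>*\<^bsub>with_proj G\<^esub> v \<longleftrightarrow> u \<in> pverts G \<and> (u, v) \<in> (parcs G)\<^sup>*" for u v
    using reachable_conv'[of u v] reachable_in_verts(1)[of u v] by auto
  have stay: "v \<in> C" if "C \<in> \<C>" "u \<in> C" "(u, v) \<in> (parcs G)\<^sup>*" for C u v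
    using that(3)
  proof (induction rule: rtrancl_induct)
    case (step v w)
    then show ?case using assms(2)[OF that(1)] arc_closedD by (auto simp: component_def)
  qed (rule that)
  have conn: "u \<rightarrow>\<^sup>*\<^bsub>with_proj G\<^esub> v" if "C \<in> \<C>" "u \<in> C" "v \<in> C" for C u v
    using that assms unfolding reach component_def by blast
  have scc: "C \<in> sccs_verts" if "C \<in> \<C>" for C
  proof -
    have "C \<noteq> {}" using assms(2)[OF that] by (simp add: component_def)
    moreover have "\<not> u \<rightarrow>\<^sup>*\<^bsub>with_proj G\<^esub> v" if "u \<in> C" "v \<notin> C" for u v
      using stay[OF \<open>C \<in> \<C>\<close> \<open>u \<in> C\<close>] that(2) reach by blast
    ultimately show ?thesis unfolding sccs_verts_def using conn[OF that] by blast
  qed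
  have "S \<in> \<C>" if "S \<in> sccs_verts" for S
  proof -
    have S: "S \<noteq> {}" "\<And>u v. u \<in> S \<Longrightarrow> v \<in> S \<Longrightarrow> u \<rightarrow>\<^sup>*\<^bsub>with_proj G\<^esub> v"
      "\<And>u v. u \<in> S \<Longrightarrow> v \<notin> S \<Longrightarrow> \<not> u \<rightarrow>\<^sup>*\<^bsub>with_proj G\<^esub> v \<or> \<not> v \<rightarrow>\<^sup>*\<^bsub>with_proj G\<^esub> u"
      using that by (simp_all add: sccs_verts_def)
    obtain u where u: "u \<in> S" using S(1) by blast
    then have "u \<in> pverts G" using S(2) reach by blast
    then obtain C where C: "C \<in> \<C>" "u \<in> C" using assms(1) by blast
    have "S \<subseteq> C" using S(2)[OF u] reach stay[OF C] by blast
    moreover have "C \<subseteq> S" using S(3)[OF u] conn[OF C(1)] C(2) by blast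
    ultimately show ?thesis using C(1) by auto
  qed
  then show ?thesis using scc by blast
qed

text \<open>Vertices, edges and faces all split along components, and the factor
  \<open>card sccs_verts\<close> supplies the 2 in each summand.\<close>

theorem euler_genus_sum:
  assumes comps: "\<Union>\<C> = pverts G" "\<And>C. C \<in> \<C> \<Longrightarrow> component C"
    and disj: "\<And>C D. C \<in> \<C> \<Longrightarrow> D \<in> \<C> \<Longrightarrow> C \<noteq> D \<Longrightarrow> C \<inter> D = {}"
    and no_isolated: "\<And>v. v \<in> pverts G \<Longrightarrow> out v \<noteq> {}"
  shows "scheme_euler_genus G rot tw =
    (\<Sum>C\<in>\<C>. 2 - int (card C) + int (card (edges C)) - int (card (faces C)))"
proof -
  have cl: "arc_closed C" "C \<subseteq> pverts G" if "C \<in> \<C>" for C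
    using comps(2)[OF that] by (auto simp: component_def arc_closed_def)
  have finC: "finite \<C>" using comps(1) fin_verts by (metis finite_UnionD)
  have "pverts G = (\<Union>C\<in>\<C>. C)" using comps(1) by simp
  then have V: "card (pverts G) = (\<Sum>C\<in>\<C>. card C)"
    using finC disj cl fin_verts finite_subset card_UN_disjoint[of \<C> "\<lambda>C. C"] by metis
  have arcs: "arcs_in (pverts G) = (\<Union>C\<in>\<C>. arcs_in C)"
    using comps(1) by (auto simp: arcs_in_def)
  have "edges (pverts G) = (\<Union>C\<in>\<C>. edges C)"
    unfolding edges_def arcs by blast
  moreover have "edges C \<inter> edges D = {}" if "C \<in> \<C>" "D \<in> \<C>" "C \<noteq> D" for C D
  proof -
    have "E \<subseteq> C \<and> E \<noteq> {}" if "E \<in> edges C" "C \<in> \<C>" for E C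
      using that cl(1) arc_closedD by (fastforce simp: edges_def arcs_in_def)
    then show ?thesis using disj that by blast
  qed
  ultimately have E: "card (edges (pverts G)) = (\<Sum>C\<in>\<C>. card (edges C))"
    using finC fin_edges card_UN_disjoint[of \<C> edges] by simp
  have states: "states (pverts G) = (\<Union>C\<in>\<C>. states C)"
    using comps(1) by (auto simp: states_def)
  then have "faces (pverts G) = (\<Union>C\<in>\<C>. faces C)"
    unfolding faces_def by blast
  moreover have "faces C \<inter> faces D = {}" if "C \<in> \<C>" "D \<in> \<C>" "C \<noteq> D" for C D
  proof -
    have sub: "f \<subseteq> states C \<and> f \<noteq> {}" if f: "f \<in> faces C" and C: "C \<in> \<C>" for f C
    proof -
      obtain x where x: "x \<in> states C" "f = face x" using f unfolding faces_def by blast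
      then have "x \<in> f" using face_self states_sub[OF cl(2)[OF C]] by blast
      then show ?thesis using x face_states[OF cl(1)[OF C]] by blast
    qed
    have "states C \<inter> states D = {}" using disj[OF that] by (auto simp: states_def)
    then show ?thesis using sub[OF _ that(1)] sub[OF _ that(2)] by blast
  qed
  ultimately have F: "card (faces (pverts G)) = (\<Sum>C\<in>\<C>. card (faces C))"
    using finC fin_faces card_UN_disjoint[of \<C> faces] by simp
  have "{v \<in> pverts G. out_arcs (with_proj G) v = {}} = {}"
    using no_isolated by (auto simp: out_arcs_def)
  then have "num_faces G rot tw = card (faces (pverts G))"
    unfolding num_faces_def facial_walks_eq by simp
  moreover have "(\<lambda>(u, v). {u, v}) ` parcs G = edges (pverts G)"
  proof -
    have "arcs_in (pverts G) = parcs G" using arc_verts by (auto simp: arcs_in_def)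
    then show ?thesis by (simp add: edges_def)
  qed
  moreover have "sccs_verts = \<C>"
    by (rule sccs_verts_components[OF comps(1)]) (rule comps(2))
  ultimately show ?thesis
    unfolding scheme_euler_genus_def by (simp add: V E F sum.distrib sum_subtractf)
qed

end

lemma euler_genus_bounds:
  assumes lower: "\<And>rot tw. embedding_scheme G rot tw \<Longrightarrow> l \<le> scheme_euler_genus G rot tw"
    and scheme: "embedding_scheme G rot tw" "scheme_euler_genus G rot tw \<le> u"
  shows "l \<le> euler_genus G" "euler_genus G \<le> u"
proof -
  let ?S = "{scheme_euler_genus G rot tw | rot tw. embedding_scheme G rot tw}"
  let ?c = "2 * int (card (pre_digraph.sccs_verts (with_proj G)))
    - int (card (pverts G)) + int (card ((\<lambda>(u, v). {u, v}) ` parcs G))"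
  \<comment> \<open>\<open>Min\<close> is meaningful because the values are bounded above by the
    value for zero faces and below by the assumption.\<close>
  have "?S \<subseteq> {l..?c}" using lower by (auto simp: scheme_euler_genus_def)
  then have fin: "finite ?S" by (rule finite_subset) simp
  have mem: "scheme_euler_genus G rot tw \<in> ?S" using scheme(1) by blast
  then show "euler_genus G \<le> u"
    using Min_le[OF fin mem] scheme(2) by (simp add: euler_genus_def)
  have "Min ?S \<in> ?S" using fin mem by (intro Min_in) auto
  then show "l \<le> euler_genus G" using lower by (auto simp: euler_genus_def)
qed

section \<open>Rotation systems from adjacency lists\<close>

lemma cycle_of_list_nth:
  assumes "distinct xs" "i < length xs"
  shows "cycle_of_list xs (xs ! i) = xs ! (Suc i mod length xs)"
proof -
  have "map (cycle_of_list xs) xs ! i = rotate 1 xs ! i"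
    using cyclic_rotation[OF assms(1), of 1] by simp
  then show ?thesis using assms(2) by (simp add: nth_rotate1)
qed

lemma cyclic_on_cycle_of_list:
  assumes "distinct xs" "xs \<noteq> []"
  shows "cyclic_on (cycle_of_list xs) (set xs)"
proof (rule cyclic_on_singleI)
  let ?f = "cycle_of_list xs"
  show "hd xs \<in> set xs" using assms(2) by simp
  have "xs ! i \<in> orbit ?f (hd xs)" if "i < length xs" for i
  proof -
    have "map (?f ^^ i) xs ! 0 = rotate i xs ! 0"
      using cyclic_rotation[OF assms(1)] by simp
    then have "xs ! i = (?f ^^ i) (hd xs)"
      using assms(2) that by (simp add: nth_rotate hd_conv_nth)
    then show ?thesis
      by (auto simp: orbit_altdef_permutation[OF permutation_of_cycle])
  qed
  then have "set xs \<subseteq> orbit ?f (hd xs)" by (auto simp: set_conv_nth)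
  moreover have "orbit ?f (hd xs) \<subseteq> set xs"
    using assms(2) cycle_permutes[of xs] by (intro orbit_closed) (auto simp: permutes_in_image)
  ultimately show "set xs = orbit ?f (hd xs)" by blast
qed

text \<open>Outside \<open>V\<close> the map is the identity, as \<open>permutes\<close> demands of
  pairs that are not arcs.\<close>

definition list_rot :: "'a set \<Rightarrow> ('a \<Rightarrow> 'a list) \<Rightarrow> 'a \<times> 'a \<Rightarrow> 'a \<times> 'a" where
  "list_rot V nbrs = (\<lambda>(u, v). if u \<in> V then (u, cycle_of_list (nbrs u) v) else (u, v))"

lemma list_rot_scheme:
  assumes arcs: "parcs G = {(u, v). u \<in> pverts G \<and> v \<in> set (nbrs u)}"
    and dist: "\<And>u. u \<in> pverts G \<Longrightarrow> distinct (nbrs u)"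
  shows "embedding_scheme G (list_rot (pverts G) nbrs) (\<lambda>_. False)"
proof -
  let ?r = "list_rot (pverts G) nbrs"
  have perm: "cycle_of_list (nbrs u) permutes set (nbrs u)" for u by (rule cycle_permutes)
  have "?r permutes parcs G"
    unfolding permutes_def
  proof (intro conjI allI impI)
    show "?r e = e" if "e \<notin> parcs G" for e
    proof (cases e)
      case (Pair u v)
      then have "u \<in> pverts G \<Longrightarrow> v \<notin> set (nbrs u)" using that by (simp add: arcs)
      then have "u \<in> pverts G \<Longrightarrow> cycle_of_list (nbrs u) v = v" using id_outside_supp by metis
      then show ?thesis using Pair by (simp add: list_rot_def)
    qed
    show "\<exists>!e'. ?r e' = e" for e
    proof (rule ex1I)
      let ?g = "\<lambda>(u, v). if u \<in> pverts G then (u, inv (cycle_of_list (nbrs u)) v) else (u, v)"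
      show "?r (?g e) = e"
        by (auto simp: list_rot_def permutes_inverses[OF perm] split: prod.splits)
      show "e' = ?g e" if "?r e' = e" for e'
        using that by (auto simp: list_rot_def permutes_inverses[OF perm] split: prod.splits if_splits)
    qed
  qed
  moreover have "cyclic_on ?r (out_arcs (with_proj G) u)"
    if u: "u \<in> pverts G" and ne: "out_arcs (with_proj G) u \<noteq> {}" for u
  proof -
    have out: "out_arcs (with_proj G) u = Pair u ` set (nbrs u)"
      using u by (auto simp: out_arcs_def arcs)
    have "nbrs u \<noteq> []" using ne out by auto
    then have "cyclic_on (cycle_of_list (nbrs u)) (set (nbrs u))"
      using cyclic_on_cycle_of_list dist[OF u] by blast
    then show ?thesis
      unfolding out by (rule cyclic_on_image) (simp add: list_rot_def u)
  qed
  ultimately show ?thesis unfolding embedding_scheme_def by simp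
qed

section \<open>The graphs\<close>

text \<open>The vertices \<open>L s v (length v)\<close>, called \<open>base s v\<close> below, form two copies (\<open>s\<close> is the side) of the
  complete binary tree of height \<open>h\<close>, whose nodes are words with the root \<open>[]\<close> and the children
  \<open>b # v\<close> of \<open>v\<close>.  A path descends from \<open>base s v\<close> through \<open>L s v i\<close> to \<open>L s v 0\<close>, which is joined to
  the end of the path of the sibling of \<open>v\<close> on the other side.  The vertices \<open>K j a\<close> form the
  copies of \<open>K\<^sub>3\<^sub>,\<^sub>3\<close>.  Both are coded as natural numbers, and \<open>vertex_case\<close> decodes them.\<close>

definition L :: "bool \<Rightarrow> bool list \<Rightarrow> nat \<Rightarrow> nat" where
  "L s v i = to_nat (Inl (s, v, i) :: (bool \<times> bool list \<times> nat) + nat \<times> nat)"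

definition K :: "nat \<Rightarrow> nat \<Rightarrow> nat" where
  "K j a = to_nat (Inr (j, a) :: (bool \<times> bool list \<times> nat) + nat \<times> nat)"

definition vertex_case ::
    "(bool \<Rightarrow> bool list \<Rightarrow> nat \<Rightarrow> 'b) \<Rightarrow> (nat \<Rightarrow> nat \<Rightarrow> 'b) \<Rightarrow> nat \<Rightarrow> 'b" where
  "vertex_case f g x = (case from_nat x :: (bool \<times> bool list \<times> nat) + nat \<times> nat of
     Inl (s, v, i) \<Rightarrow> f s v i | Inr (j, a) \<Rightarrow> g j a)"

lemma L_inject [simp]: "L s v i = L s' v' i' \<longleftrightarrow> s = s' \<and> v = v' \<and> i = i'"
  and K_inject [simp]: "K j a = K j' a' \<longleftrightarrow> j = j' \<and> a = a'"
  and L_neq_K [simp]: "L s v i \<noteq> K j a" "K j a \<noteq> L s v i"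
  by (simp_all add: L_def K_def)

lemma vertex_case_simps [simp]:
  "vertex_case f g (L s v i) = f s v i" "vertex_case f g (K j a) = g j a"
  by (simp_all add: vertex_case_def L_def K_def)

definition sib :: "bool list \<Rightarrow> bool list" where
  "sib v = (\<not> hd v) # tl v"

definition up :: "bool \<Rightarrow> bool list \<Rightarrow> nat \<Rightarrow> nat" where
  "up s v i = (if i = 0 then L (\<not> s) (sib v) 0 else L s v (i - 1))"

definition base :: "bool \<Rightarrow> bool list \<Rightarrow> nat" where
  "base s v = L s v (length v)"

text \<open>The walk around a hexagon enters a \<open>True\<close> child from its parent and leaves
  it along the path, and passes a \<open>False\<close> child the other way round; hence the two
  orders.\<close>

definition parent_nbrs :: "bool \<Rightarrow> bool list \<Rightarrow> nat list" where
  "parent_nbrs s v = (case v of [] \<Rightarrow> []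
     | b # w \<Rightarrow> if b then [base s w, L s v (length w)] else [L s v (length w), base s w])"

definition child_nbrs :: "nat \<Rightarrow> bool \<Rightarrow> bool list \<Rightarrow> nat list" where
  "child_nbrs h s v = (if length v < h then [base s (False # v), base s (True # v)] else [])"

text \<open>The cyclic order of these lists is a rotation system in which all hexagons are faces.\<close>

definition nbrs :: "nat \<Rightarrow> nat \<Rightarrow> nat list" where
  "nbrs h = vertex_case
     (\<lambda>s v i. if i < length v then [L s v (Suc i), up s v i] else parent_nbrs s v @ child_nbrs h s v)
     (\<lambda>j a. [K j ((a + 1) mod 6), K j ((a + 3) mod 6), K j ((a + 5) mod 6)])"

definition main_verts :: "nat \<Rightarrow> nat set" where
  "main_verts h = {L s v i | s v i. i \<le> length v \<and> length v \<le> h}"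

definition K33_verts :: "nat \<Rightarrow> nat set" where
  "K33_verts j = K j ` {..<6}"

definition ladder_graph :: "nat \<Rightarrow> nat \<Rightarrow> nat pair_pre_digraph" where
  "ladder_graph h n = (let V = main_verts h \<union> (\<Union>j<n. K33_verts j)
     in \<lparr> pverts = V, parcs = {(x, y). x \<in> V \<and> y \<in> set (nbrs h x)} \<rparr>)"

text \<open>One direction of each edge, so that facts symmetric in the two ends need only four
  cases.\<close>

inductive half_arc :: "nat \<Rightarrow> nat \<Rightarrow> nat \<Rightarrow> nat \<Rightarrow> bool" for h n where
  ladder: "i < length v \<Longrightarrow> length v \<le> h \<Longrightarrow> half_arc h n (L s v (Suc i)) (L s v i)"
| parent: "length v < h \<Longrightarrow> half_arc h n (L s (b # v) (Suc (length v))) (L s v (length v))"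
| cross: "length v < h \<Longrightarrow> half_arc h n (L True (b # v) 0) (L False ((\<not> b) # v) 0)"
| bipartite: "j < n \<Longrightarrow> a < 6 \<Longrightarrow> b < 6 \<Longrightarrow> even a \<Longrightarrow> odd b \<Longrightarrow> half_arc h n (K j a) (K j b)"

lemma pverts_ladder_graph: "pverts (ladder_graph h n) = main_verts h \<union> (\<Union>j<n. K33_verts j)"
  by (simp add: ladder_graph_def Let_def)

lemma L_in_graph [simp]: "L s v i \<in> pverts (ladder_graph h n) \<longleftrightarrow> i \<le> length v \<and> length v \<le> h"
  by (auto simp: pverts_ladder_graph main_verts_def K33_verts_def)

lemma K_in_graph [simp]: "K j a \<in> pverts (ladder_graph h n) \<longleftrightarrow> j < n \<and> a < 6"
  by (auto simp: pverts_ladder_graph main_verts_def K33_verts_def)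

lemma graph_cases:
  assumes "x \<in> pverts (ladder_graph h n)"
  obtains (main) s v i where "x = L s v i" "i \<le> length v" "length v \<le> h"
    | (K33) j a where "x = K j a" "j < n" "a < 6"
  using assms by (auto simp: pverts_ladder_graph main_verts_def K33_verts_def)

lemma parcs_ladder_graph: "(x, y) \<in> parcs (ladder_graph h n) \<longleftrightarrow> x \<in> pverts (ladder_graph h n) \<and> y \<in> set (nbrs h x)"
  by (simp add: ladder_graph_def Let_def)

lemma nbrs_L: "nbrs h (L s v i) =
    (if i < length v then [L s v (Suc i), up s v i] else parent_nbrs s v @ child_nbrs h s v)"
  and nbrs_K: "nbrs h (K j a) = [K j ((a + 1) mod 6), K j ((a + 3) mod 6), K j ((a + 5) mod 6)]"
  by (simp_all add: nbrs_def)

lemma less_6: "a < 6 \<longleftrightarrow> a \<in> {0, 1, 2, 3, 4, 5 :: nat}"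
  by auto

lemma set_nbrs_K: "a < 6 \<Longrightarrow> set (nbrs h (K j a)) = {K j b | b. b < 6 \<and> even b \<noteq> even a}"
  unfolding less_6 nbrs_K by (auto simp: less_6)

text \<open>This is where the adjacency lists, written separately for each vertex, are seen to agree
  at the two ends of an edge.\<close>

lemma arc_iff_half:
  "(x, y) \<in> parcs (ladder_graph h n) \<longleftrightarrow> half_arc h n x y \<or> half_arc h n y x"
proof
  assume "(x, y) \<in> parcs (ladder_graph h n)"
  then have x: "x \<in> pverts (ladder_graph h n)" and y: "y \<in> set (nbrs h x)" by (simp_all add: parcs_ladder_graph)
  from x show "half_arc h n x y \<or> half_arc h n y x"
  proof (cases rule: graph_cases)
    case (main s v i)
    show ?thesis
    proof (cases "i < length v")
      case True
      then consider "y = L s v (Suc i)" | "y = up s v i" using y main(1) by (auto simp: nbrs_L)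
      then show ?thesis
      proof cases
        case 2
        show ?thesis
        proof (cases i)
          case 0
          obtain b w where "v = b # w" using True by (cases v) auto
          then show ?thesis
            using 2 0 main half_arc.cross[of w h n b] half_arc.cross[of w h n "\<not> b"]
            by (cases s) (auto simp: up_def sib_def)
        next
          case (Suc i')
          then show ?thesis
            using 2 True main half_arc.ladder[of i' v h n s] by (simp add: up_def)
        qed
      qed (use True main half_arc.ladder in auto)
    next
      case False
      then have "i = length v" using main by simp
      moreover have "y \<in> set (parent_nbrs s v) \<or> y \<in> set (child_nbrs h s v)"
        using False y main(1) by (simp add: nbrs_L)
      then consider b w where "v = b # w" "y = L s w (length w) \<or> y = L s v (length w)"
        | b where "length v < h" "y = L s (b # v) (Suc (length v))"
        by (cases v) (auto simp: parent_nbrs_def child_nbrs_def base_def split: if_splits)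
      then show ?thesis
      proof cases
        case (1 b w)
        then show ?thesis
          using calculation main half_arc.parent[of w h n s b] half_arc.ladder[of "length w" v h n s]
          by auto
      next
        case (2 b)
        then show ?thesis using calculation main(1) half_arc.parent[of v h n s b] by auto
      qed
    qed
  next
    case (K33 j a)
    then show ?thesis using y half_arc.bipartite[of j n] by (cases "even a") (auto simp: set_nbrs_K)
  qed
next
  have "(x, y) \<in> parcs (ladder_graph h n) \<and> (y, x) \<in> parcs (ladder_graph h n)" if "half_arc h n x y" for x y
    using that
  proof cases
    case (parent v s b)
    then show ?thesis
      by (cases b) (auto simp: parcs_ladder_graph nbrs_L parent_nbrs_def child_nbrs_def base_def)
  next
    case (ladder i v s)
    then show ?thesis
      by (cases "Suc i = length v"; cases v)
        (auto simp: parcs_ladder_graph nbrs_L up_def parent_nbrs_def)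
  qed (auto simp: parcs_ladder_graph nbrs_L up_def sib_def set_nbrs_K)
  then show "half_arc h n x y \<or> half_arc h n y x \<Longrightarrow> (x, y) \<in> parcs (ladder_graph h n)" by blast
qed

lemma half_arc_neq: "half_arc h n x y \<Longrightarrow> x \<noteq> y"
  by (cases rule: half_arc.cases) auto

lemma pair_graph_ladder_graph: "pair_graph (ladder_graph h n)"
proof
  have in_verts: "x \<in> pverts (ladder_graph h n) \<and> y \<in> pverts (ladder_graph h n)"
    if "(x, y) \<in> parcs (ladder_graph h n)" for x y
    using that parcs_ladder_graph arc_iff_half by blast
  then show "fst e \<in> pverts (ladder_graph h n)" "snd e \<in> pverts (ladder_graph h n)"
    if "e \<in> parcs (ladder_graph h n)" for e
    using that by (metis prod.collapse)+
  have "main_verts h \<subseteq> (\<lambda>(s, v, i). L s v i) ` ((UNIV :: bool set) \<times> {v. set v \<subseteq> UNIV \<and> length v \<le> h} \<times> {..h})"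
    by (force simp: main_verts_def)
  moreover have "finite ((UNIV :: bool set) \<times> {v :: bool list. set v \<subseteq> UNIV \<and> length v \<le> h} \<times> {..h})"
    by (intro finite_cartesian_product finite_lists_length_le) auto
  ultimately have "finite (main_verts h)" by (meson finite_imageI finite_subset)
  then show fin: "finite (pverts (ladder_graph h n))" by (simp add: pverts_ladder_graph K33_verts_def)
  have "parcs (ladder_graph h n) \<subseteq> pverts (ladder_graph h n) \<times> pverts (ladder_graph h n)" using in_verts by auto
  then show "finite (parcs (ladder_graph h n))" using fin by (meson finite_SigmaI finite_subset)
  show "fst e \<noteq> snd e" if "e \<in> parcs (ladder_graph h n)" for e
    using that half_arc_neq arc_iff_half by (metis prod.collapse)
  show "symmetric (with_proj (ladder_graph h n))"
    using arc_iff_half by (auto simp: symmetric_def sym_def)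
qed

lemma distinct_nbrs:
  assumes "x \<in> pverts (ladder_graph h n)"
  shows "distinct (nbrs h x)"
  using assms
proof (cases rule: graph_cases)
  case (main s v i)
  then show ?thesis
    by (cases v) (auto simp: nbrs_L up_def parent_nbrs_def child_nbrs_def base_def)
next
  case (K33 j a)
  then show ?thesis unfolding K33(1) nbrs_K using K33(3) unfolding less_6 by auto
qed

section \<open>Distances and the comatching\<close>

lemma hop_dist_le:
  assumes "pair_graph G" "u \<in> pverts G" "(u, v) \<in> parcs G ^^ m"
  shows "hop_dist G u v \<le> ereal (real m)"
proof -
  interpret pair_graph G by (rule assms(1))
  have "\<exists>p. awalk u p v \<and> length p = m"
    using assms(3)
  proof (induction m arbitrary: v)
    case 0
    then show ?case using assms(2) by (auto intro!: exI[of _ "[]"] simp: awalk_Nil_iff)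
  next
    case (Suc m)
    then obtain w p where w: "(w, v) \<in> parcs G" "awalk u p w" "length p = m"
      by (metis relpow_Suc_E)
    then have "awalk w [(w, v)] v" using in_arcsD1 in_arcsD2 by (auto simp: awalk_simps)
    then have "awalk u (p @ [(w, v)]) v" using w(2) by (rule awalk_appendI[rotated])
    then show ?case using w(3) by (intro exI[of _ "p @ [(w, v)]"]) simp
  qed
  then obtain p where p: "awalk u p v" "length p = m" by blast
  have "awalk_cost (\<lambda>_. 1) p = real m"
    unfolding awalk_cost_def using p(2) by (simp add: sum_list_triv)
  then show ?thesis
    unfolding hop_dist_def using min_cost_le_walk_cost[OF p(1), of "\<lambda>_. 1"] by simp
qed

text \<open>The dual bound for shortest paths: a potential that rises by at most 1 per arc needs as
  many arcs as it gains.\<close>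

lemma hop_dist_ge:
  fixes f :: "'a \<Rightarrow> int"
  assumes "pair_graph G" "\<And>x y. (x, y) \<in> parcs G \<Longrightarrow> f y \<le> f x + 1"
  shows "hop_dist G u v \<ge> ereal (real_of_int (f v - f u))"
proof -
  interpret pair_graph G by (rule assms(1))
  have "f v - f u \<le> int (length p)" if "awalk u p v" for p
    using that
  proof (induction p arbitrary: u)
    case (Cons e p)
    then have "e \<in> parcs G" "fst e = u" "awalk (snd e) p v" by (auto simp: awalk_Cons_iff)
    then have "f (snd e) \<le> f u + 1" "f v - f (snd e) \<le> int (length p)"
      using Cons.IH assms(2)[of "fst e" "snd e"] by auto
    then show ?case by simp
  qed (auto simp: awalk_Nil_iff)
  moreover have "awalk_cost (\<lambda>_. 1) p = real (length p)" for p
    unfolding awalk_cost_def by (simp add: sum_list_triv)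
  ultimately have "ereal (real_of_int (f v - f u)) \<le> ereal (awalk_cost (\<lambda>_. 1) p)"
    if "awalk u p v" for p
    using that by (metis ereal_less_eq(3) of_int_le_iff of_int_of_nat_eq)
  then show ?thesis
    unfolding hop_dist_def \<mu>_def by (intro INF_greatest) simp
qed

lemma sym_relpow: "sym R \<Longrightarrow> (x, y) \<in> R ^^ m \<Longrightarrow> (y, x) \<in> R ^^ m"
proof (induction m arbitrary: y)
  case (Suc m)
  then obtain z where "(x, z) \<in> R ^^ m" "(z, y) \<in> R" by auto
  then show ?case using Suc by (intro relpow_Suc_I2[of y z]) (auto dest: symD)
qed simp

lemma sym_parcs_ladder_graph: "sym (parcs (ladder_graph h n))"
  using arc_iff_half by (auto simp: sym_def)

lemma arc_symI:
  "half_arc h n x y \<Longrightarrow> (x, y) \<in> parcs (ladder_graph h n)" "half_arc h n y x \<Longrightarrow> (x, y) \<in> parcs (ladder_graph h n)"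
  by (simp_all add: arc_iff_half)

lemma walk_base:
  "length (a @ v) \<le> h \<Longrightarrow> (base s (a @ v), base s v) \<in> parcs (ladder_graph h n) ^^ length a"
proof (induction a)
  case (Cons b a)
  then have "(base s (b # a @ v), base s (a @ v)) \<in> parcs (ladder_graph h n)"
    using half_arc.parent[of "a @ v" h n s b] by (intro arc_symI(1)) (simp add: base_def)
  moreover have "(base s (a @ v), base s v) \<in> parcs (ladder_graph h n) ^^ length a"
    using Cons by simp
  ultimately have "(base s (b # a @ v), base s v) \<in> parcs (ladder_graph h n) ^^ Suc (length a)"
    by (rule relpow_Suc_I2)
  then show ?case by simp
qed simp

lemma walk_ladder:
  "i \<le> length v \<Longrightarrow> length v \<le> h \<Longrightarrow> (L s v i, L s v 0) \<in> parcs (ladder_graph h n) ^^ i"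
proof (induction i)
  case (Suc i)
  then have "(L s v (Suc i), L s v i) \<in> parcs (ladder_graph h n)"
    using half_arc.ladder[of i v h n s] by (intro arc_symI(1)) simp
  moreover have "(L s v i, L s v 0) \<in> parcs (ladder_graph h n) ^^ i" using Suc by simp
  ultimately show ?case by (rule relpow_Suc_I2)
qed simp

lemma arc_cross:
  "length v < h \<Longrightarrow> (L s (b # v) 0, L (\<not> s) ((\<not> b) # v) 0) \<in> parcs (ladder_graph h n)"
  using half_arc.cross[of v h n b] half_arc.cross[of v h n "\<not> b"]
  by (cases s) (auto intro: arc_symI)

text \<open>Words grow at the front, so the longest common suffix \<open>v\<close> is the lowest
  common ancestor of the two leaves, and the letters before it name the children where they
  split.\<close>

lemma different_suffix:
  fixes w w' :: "bool list"
  assumes "length w = length w'" "w \<noteq> w'"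
  obtains a a' b v where "w = a @ b # v" "w' = a' @ (\<not> b) # v"
proof -
  obtain pre x xs y ys where xy: "x \<noteq> y" "rev w = pre @ [x] @ xs" "rev w' = pre @ [y] @ ys"
    using same_length_different[of "rev w" "rev w'"] assms by auto
  then have "w = rev xs @ x # rev pre" "w' = rev ys @ (\<not> x) # rev pre"
    by (auto simp: rev_swap)
  then show thesis by (rule that)
qed

lemma walk_opposite:
  assumes "length w = h" "length w' = h" "w \<noteq> w'"
  shows "(base s w, base (\<not> s) w') \<in> parcs (ladder_graph h n) ^^ (2 * h + 1)"
proof -
  let ?A = "parcs (ladder_graph h n)"
  obtain a a' b v where w: "w = a @ b # v" "w' = a' @ (\<not> b) # v"
    using different_suffix assms by metis
  let ?m = "Suc (length v)"
  \<comment> \<open>Climbing to depth \<open>?m\<close> takes \<open>h - ?m\<close> steps and the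
    half path takes \<open>?m\<close>, so the total is \<open>h\<close> at every depth.\<close>
  have half: "(base t (c @ d # v), L t (d # v) 0) \<in> ?A ^^ h" if "length c + ?m = h" for t c d
  proof -
    have "(base t (c @ d # v), base t (d # v)) \<in> ?A ^^ length c"
      using that by (intro walk_base) simp
    moreover have "(base t (d # v), L t (d # v) 0) \<in> ?A ^^ ?m"
      unfolding base_def using that walk_ladder[of ?m "d # v" h t n] by simp
    ultimately have "(base t (c @ d # v), L t (d # v) 0) \<in> ?A ^^ (length c + ?m)"
      unfolding relpow_add by (rule relcompI)
    then show ?thesis unfolding that .
  qed
  have "(base s w, L s (b # v) 0) \<in> ?A ^^ h"
    unfolding w(1) by (rule half) (use assms w in simp)
  moreover have "(L s (b # v) 0, L (\<not> s) ((\<not> b) # v) 0) \<in> ?A"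
    by (rule arc_cross) (use assms w in simp)
  ultimately have "(base s w, L (\<not> s) ((\<not> b) # v) 0) \<in> ?A ^^ Suc h" by (rule relpow_Suc_I)
  moreover have "(L (\<not> s) ((\<not> b) # v) 0, base (\<not> s) w') \<in> ?A ^^ h"
    unfolding w(2) by (rule sym_relpow[OF sym_parcs_ladder_graph half]) (use assms w in simp)
  ultimately have "(base s w, base (\<not> s) w') \<in> ?A ^^ (Suc h + h)"
    unfolding relpow_add by (rule relcompI)
  then show ?thesis by (simp add: mult_2)
qed

lemma walk_same_side:
  assumes "length w = h" "length w' = h"
  shows "(base s w, base s w') \<in> parcs (ladder_graph h n) ^^ (2 * h)"
proof -
  have "(base s w, base s []) \<in> parcs (ladder_graph h n) ^^ h" if "length w = h" for w
    using walk_base[of w "[]" h s n] that by simp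
  then have "(base s w, base s []) \<in> parcs (ladder_graph h n) ^^ h"
    "(base s [], base s w') \<in> parcs (ladder_graph h n) ^^ h"
    using assms sym_relpow[OF sym_parcs_ladder_graph] by blast+
  then have "(base s w, base s w') \<in> parcs (ladder_graph h n) ^^ (h + h)"
    unfolding relpow_add by (rule relcompI)
  then show ?thesis by (simp add: mult_2)
qed

text \<open>A lower bound for the distance from the leaf \<open>w\<close> on side \<open>t\<close>,
  running from 0 there to \<open>2 * h + 3\<close> at its twin. The words that are suffixes of
  \<open>w\<close> are its ancestors: leaving their line on side \<open>t\<close>, or rejoining it
  on the other side, is worth 2.\<close>

definition potential :: "nat \<Rightarrow> bool \<Rightarrow> bool list \<Rightarrow> nat \<Rightarrow> int" where
  "potential h t w = vertex_case
     (\<lambda>s v i. if s = t then int h - int i + (if suffix v w then 0 else 2)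
              else int h + int i + (if suffix v w then 3 else 1))
     (\<lambda>_ _. 0)"

lemma suffix_ConsD: "suffix (b # v) w \<Longrightarrow> suffix v w"
  by (auto simp: suffix_def)

lemma suffix_Cons_unique:
  assumes "suffix (b # v) w" "suffix ((\<not> b) # v) w"
  shows False
proof -
  obtain x y where "w = x @ b # v" "w = y @ (\<not> b) # v"
    using assms by (auto simp: suffix_def)
  then show False by (metis append_eq_append_conv length_Cons list.inject)
qed

text \<open>The critical case is a crossing, which would jump by 3 if it led from the ancestor line
  of \<open>w\<close> to its counterpart; but \<open>b # v\<close> and \<open>(\<not> b) # v\<close>
  are not both suffixes of \<open>w\<close>.\<close>

lemma potential_half_arc:
  assumes "half_arc h n x y"
  shows "\<bar>potential h t w x - potential h t w y\<bar> \<le> 1"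
  using assms
proof cases
  case (cross v b)
  then show ?thesis
    using suffix_Cons_unique[of b v w] by (auto simp: potential_def)
qed (auto simp: potential_def dest: suffix_ConsD)

lemma dist_opposite:
  assumes "length w = h"
  shows "hop_dist (ladder_graph h n) (base s w) (base (\<not> s) w) \<ge> ereal (real (2 * h + 3))"
proof -
  have "potential h s w y \<le> potential h s w x + 1" if "(x, y) \<in> parcs (ladder_graph h n)" for x y
  proof -
    have "\<bar>potential h s w x - potential h s w y\<bar> \<le> 1"
      using that potential_half_arc[of h n x y s w] potential_half_arc[of h n y x s w]
      unfolding arc_iff_half by fastforce
    then show ?thesis by linarith
  qed
  then have "hop_dist (ladder_graph h n) (base s w) (base (\<not> s) w) \<ge>
    ereal (real_of_int (potential h s w (base (\<not> s) w) - potential h s w (base s w)))"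
    by (rule hop_dist_ge[OF pair_graph_ladder_graph])
  moreover have "potential h s w (base (\<not> s) w) - potential h s w (base s w) = 2 * int h + 3"
    using assms by (auto simp: potential_def base_def)
  ultimately show ?thesis by simp
qed

definition matching :: "nat \<Rightarrow> (nat \<times> nat) set" where
  "matching h = (\<lambda>(s, w). (base s w, base (\<not> s) w)) ` (UNIV \<times> {w. length w = h})"

lemma matchingE:
  assumes "(p, q) \<in> matching h"
  obtains s w where "p = base s w" "q = base (\<not> s) w" "length w = h"
  using assms by (auto simp: matching_def)

lemma card_matching: "card (matching h) = 2 ^ (h + 1)"
proof -
  have "card (matching h) = card ((UNIV :: bool set) \<times> {w :: bool list. length w = h})"
    unfolding matching_def by (rule card_image) (auto simp: inj_on_def base_def)
  moreover have "card {w :: bool list. length w = h} = 2 ^ h"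
    using card_lists_length_eq[of "UNIV :: bool set" h] by simp
  ultimately show ?thesis by (simp add: card_cartesian_product)
qed

lemma comatching_matching: "comatching (ladder_graph h n) (2 * h + 1) (matching h)"
  unfolding comatching_def
proof (intro conjI)
  show "matching h \<subseteq> pverts (ladder_graph h n) \<times> pverts (ladder_graph h n)"
    by (auto simp: matching_def base_def)
  have "ereal (real (2 * h + 1)) < ereal (real (2 * h + 3))" by simp
  then have "hop_dist (ladder_graph h n) (base s w) (base (\<not> s) w) > ereal (real (2 * h + 1))"
    if "length w = h" for s w
    using dist_opposite[OF that] by (rule order_less_le_trans)
  then show "\<forall>(p, q)\<in>matching h. ereal (real (2 * h + 1)) < hop_dist (ladder_graph h n) p q"
    by (force simp: matching_def)
  \<comment> \<open>For \<open>s = s'\<close> the two leaves are in opposite copies and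
    \<open>w \<noteq> w'\<close>, so they are joined by a crossing. Otherwise both are in the same
    copy and the route through its root has length \<open>2 * h\<close>.\<close>
  have "hop_dist (ladder_graph h n) (base s w) (base (\<not> s') w') \<le> ereal (real (2 * h + 1))"
    if w: "length w = h" "length w' = h" and ne: "(s, w) \<noteq> (s', w')" for s w s' w'
  proof (cases "s = s'")
    case True
    then show ?thesis
      using walk_opposite[OF w] ne w
      by (intro hop_dist_le[OF pair_graph_ladder_graph]) (simp_all add: base_def)
  next
    case False
    then have "(\<not> s') = s" by blast
    then have "hop_dist (ladder_graph h n) (base s w) (base (\<not> s') w') \<le> ereal (real (2 * h))"
      using walk_same_side[OF w] w
      by (intro hop_dist_le[OF pair_graph_ladder_graph]) (simp_all add: base_def)
    also have "\<dots> \<le> ereal (real (2 * h + 1))" by simp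
    finally show ?thesis .
  qed
  note le = this
  have "hop_dist (ladder_graph h n) p q' \<le> ereal (real (2 * h + 1))"
    if m: "(p, q) \<in> matching h" "(p', q') \<in> matching h" and ne: "(p, q) \<noteq> (p', q')" for p q p' q'
  proof -
    obtain s w where 1: "p = base s w" "q = base (\<not> s) w" "length w = h"
      using m(1) by (rule matchingE)
    obtain s' w' where 2: "p' = base s' w'" "q' = base (\<not> s') w'" "length w' = h"
      using m(2) by (rule matchingE)
    have "(s, w) \<noteq> (s', w')" using ne 1 2 by blast
    then show ?thesis unfolding 1(1) 2(2) by (rule le[OF 1(3) 2(3)])
  qed
  then show "\<forall>(p, q)\<in>matching h. \<forall>(p', q')\<in>matching h. (p, q) \<noteq> (p', q') \<longrightarrow>
      hop_dist (ladder_graph h n) p q' \<le> ereal (real (2 * h + 1))"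
    by blast
qed

section \<open>The tree decomposition\<close>

text \<open>The nodes of the tree are coded like vertices: \<open>L s v i\<close> with \<open>i > 0\<close> covers the \<open>i\<close>-th rungs
  of the two paths that cross between the children of \<open>v\<close>, and \<open>gadget v\<close> is coded by \<open>i = 0\<close>.\<close>

definition gadget :: "bool list \<Rightarrow> nat" where
  "gadget v = L False v 0"

definition nodes :: "nat \<Rightarrow> nat \<Rightarrow> nat set" where
  "nodes h n = gadget ` {v. length v < h} \<union>
     {L s v i | s v i. length v < h \<and> 0 < i \<and> i \<le> Suc (length v)} \<union> (\<lambda>j. K j 0) ` {..<n}"

text \<open>The rungs belonging to \<open>v\<close> form two chains attached to
  \<open>gadget v\<close> by their last rung \<open>i = Suc (length v)\<close>, where the paths end
  at the children of \<open>v\<close>. The nodes \<open>K j 0\<close> hang at the root with empty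
  adhesion. \<open>node_rank\<close> is the depth in this tree.\<close>

definition node_parent :: "nat \<Rightarrow> nat" where
  "node_parent = vertex_case
     (\<lambda>s v i. if i = 0 then gadget (tl v) else if i \<le> length v then L s v (Suc i) else gadget v)
     (\<lambda>j a. gadget [])"

definition node_rank :: "nat \<Rightarrow> nat" where
  "node_rank = vertex_case
     (\<lambda>s v i. if i = 0 then length v else length v + (length v + 2 - i)) (\<lambda>j a. 1)"

definition node_bag :: "nat \<Rightarrow> nat set" where
  "node_bag = vertex_case
     (\<lambda>s v i. if i = 0 then {base t u | t u. u \<in> {v, True # v, False # v}}
        else {L s (True # v) i, L s (True # v) (i - 1),
              L (\<not> s) (False # v) i, L (\<not> s) (False # v) (i - 1)})
     (\<lambda>j a. K33_verts j)"

text \<open>The rungs of side \<open>t\<close> contain the paths of \<open>(t, True # w)\<close> and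
  \<open>(\<not> t, False # w)\<close>, so the path of \<open>(s, b # w)\<close> has
  \<open>t = (s = b)\<close>. A base first occurs in the gadget of its parent, and
  \<open>tl [] = []\<close> sends the two roots to the root gadget.\<close>

definition top_node :: "nat \<Rightarrow> nat" where
  "top_node = vertex_case
     (\<lambda>s v i. if i = length v then gadget (tl v) else L (s = hd v) (tl v) (Suc i)) (\<lambda>j a. K j 0)"

text \<open>In the ladder part every edge changes \<open>i\<close> by one, except for the crossings,
  which change \<open>s\<close> at \<open>i = 0\<close>.\<close>

definition colour :: "nat \<Rightarrow> bool" where
  "colour = vertex_case (\<lambda>s v i. s \<noteq> even i) (\<lambda>j a. even a)"

lemma node_parent_simps [simp]:
  "node_parent (gadget v) = gadget (tl v)"
  "0 < i \<Longrightarrow> i \<le> length v \<Longrightarrow> node_parent (L s v i) = L s v (Suc i)"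
  "length v < i \<Longrightarrow> node_parent (L s v i) = gadget v"
  "node_parent (K j a) = gadget []"
  by (auto simp: node_parent_def gadget_def)

lemma node_rank_simps [simp]:
  "node_rank (gadget v) = length v"
  "0 < i \<Longrightarrow> node_rank (L s v i) = length v + (length v + 2 - i)"
  "node_rank (K j a) = 1"
  by (auto simp: node_rank_def gadget_def)

lemma node_bag_simps [simp]:
  "node_bag (gadget v) = {base t u | t u. u \<in> {v, True # v, False # v}}"
  "0 < i \<Longrightarrow> node_bag (L s v i) = {L s (True # v) i, L s (True # v) (i - 1),
     L (\<not> s) (False # v) i, L (\<not> s) (False # v) (i - 1)}"
  "node_bag (K j a) = K33_verts j"
  by (auto simp: node_bag_def gadget_def)

lemma top_node_simps [simp]:
  "top_node (base s v) = gadget (tl v)"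
  "i \<noteq> length v \<Longrightarrow> top_node (L s v i) = L (s = hd v) (tl v) (Suc i)"
  "top_node (K j a) = K j 0"
  by (auto simp: top_node_def base_def)

lemma colour_simps [simp]:
  "colour (L s v i) \<longleftrightarrow> s \<noteq> even i" "colour (K j a) \<longleftrightarrow> even a"
  by (simp_all add: colour_def)

lemma gadget_inject [simp]: "gadget v = gadget w \<longleftrightarrow> v = w"
  and gadget_neq [simp]: "0 < i \<Longrightarrow> L s v i \<noteq> gadget w" "0 < i \<Longrightarrow> gadget w \<noteq> L s v i"
    "gadget w \<noteq> K j a" "K j a \<noteq> gadget w"
  by (auto simp: gadget_def)

lemma nodes_cases:
  assumes "t \<in> nodes h n"
  obtains (gadget) v where "t = gadget v" "length v < h"
    | (rung) s v i where "t = L s v i" "length v < h" "0 < i" "i \<le> length v"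
    | (last_rung) s v where "t = L s v (Suc (length v))" "length v < h"
    | (K33) j where "t = K j 0" "j < n"
proof -
  have "(\<exists>v. t = gadget v \<and> length v < h) \<or>
    (\<exists>s v i. t = L s v i \<and> length v < h \<and> 0 < i \<and> i \<le> Suc (length v)) \<or> (\<exists>j. t = K j 0 \<and> j < n)"
    using assms unfolding nodes_def by blast
  then show thesis
    using that by (metis le_Suc_eq)
qed

lemma nodes_simps [simp]:
  "gadget v \<in> nodes h n \<longleftrightarrow> length v < h"
  "0 < i \<Longrightarrow> L s v i \<in> nodes h n \<longleftrightarrow> length v < h \<and> i \<le> Suc (length v)"
  "K j 0 \<in> nodes h n \<longleftrightarrow> j < n"
  by (auto simp: nodes_def image_iff)

lemma base_eq_L [simp]: "base s v = L s' v' i \<longleftrightarrow> s = s' \<and> v = v' \<and> i = length v"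
  "L s' v' i = base s v \<longleftrightarrow> s = s' \<and> v = v' \<and> i = length v"
  "base s v = base s' v' \<longleftrightarrow> s = s' \<and> v = v'"
  by (auto simp: base_def)

lemma base_neq_K [simp]: "base s v \<noteq> K j a" "K j a \<noteq> base s v"
  by (simp_all add: base_def)

lemma colour_base [simp]: "colour (base s v) \<longleftrightarrow> s \<noteq> even (length v)"
  by (simp add: base_def)

lemma card_3: "S \<subseteq> {a, b, c} \<Longrightarrow> card S \<le> 3"
proof -
  assume "S \<subseteq> {a, b, c}"
  then have "card S \<le> card (set [a, b, c])" by (intro card_mono) auto
  also have "\<dots> \<le> 3" using card_length[of "[a, b, c]"] by simp
  finally show ?thesis .
qed

lemma rooted_tree_nodes:
  assumes "0 < h"
  shows "rooted_tree (nodes h n) (gadget []) node_parent node_rank"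
proof
  have "nodes h n \<subseteq> (\<lambda>(s, v, i). L s v i) ` ((UNIV :: bool set) \<times> {v. set v \<subseteq> UNIV \<and> length v \<le> h} \<times> {..Suc h})
    \<union> (\<lambda>j. K j 0) ` {..<n}"
    by (force simp: nodes_def gadget_def image_iff)
  moreover have "finite ((UNIV :: bool set) \<times> {v :: bool list. set v \<subseteq> UNIV \<and> length v \<le> h} \<times> {..Suc h})"
    by (intro finite_cartesian_product finite_lists_length_le) auto
  ultimately show "finite (nodes h n)" by (meson finite_Un finite_imageI finite_lessThan finite_subset)
  show "gadget [] \<in> nodes h n" using assms by simp
  have "node_parent t \<in> nodes h n \<and> node_rank (node_parent t) < node_rank t"
    if "t \<in> nodes h n" "t \<noteq> gadget []" for t
    using that(1)
  proof (cases rule: nodes_cases)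
    case (gadget v)
    then have "v \<noteq> []" using that(2) by auto
    then show ?thesis using gadget by auto
  qed (use assms in auto)
  then show "node_parent t \<in> nodes h n" "node_rank (node_parent t) < node_rank t"
    if "t \<in> nodes h n" "t \<noteq> gadget []" for t
    using that by blast+
qed

lemma rooted_decomposition_nodes:
  assumes "0 < h"
  shows "rooted_decomposition (nodes h n) (gadget []) node_parent node_rank (ladder_graph h n) node_bag top_node"
proof (rule rooted_decomposition.intro[OF rooted_tree_nodes[OF assms]],
      rule rooted_decomposition_axioms.intro)
  show "pair_graph (ladder_graph h n)" by (rule pair_graph_ladder_graph)
  show "node_bag t \<subseteq> pverts (ladder_graph h n)" if "t \<in> nodes h n" for t
    using that by (cases rule: nodes_cases) (auto simp: pverts_ladder_graph[of h n] K33_verts_def main_verts_def base_def)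
  show "top_node x \<in> nodes h n \<and> x \<in> node_bag (top_node x)" if "x \<in> pverts (ladder_graph h n)" for x
    using that
  proof (cases rule: graph_cases)
    case (main s v i)
    show ?thesis
    proof (cases "i = length v")
      case True
      then have "x = base s v" using main by (simp add: base_def)
      then show ?thesis using main(3) assms by (cases v) auto
    next
      case False
      then obtain b w where "v = b # w" using main by (cases v) auto
      then show ?thesis using main False by (cases b) auto
    qed
  qed (auto simp: K33_verts_def)
  show "t \<noteq> gadget [] \<and> x \<in> node_bag (node_parent t)"
    if "t \<in> nodes h n" and x: "x \<in> node_bag t" and "t \<noteq> top_node x" for t x
    using that(1)
  proof (cases rule: nodes_cases)
    case (gadget v)
    then show ?thesis using that by (cases v) auto
  next
    case (rung s v i)
    then show ?thesis using that by auto
  next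
    case (last_rung s v)
    then show ?thesis using that by (auto simp: base_def)
  next
    case (K33 j)
    then show ?thesis using that by (auto simp: K33_verts_def)
  qed
  have "\<exists>t\<in>nodes h n. x \<in> node_bag t \<and> y \<in> node_bag t" if "half_arc h n x y" for x y
    using that
  proof cases
    case (ladder i v s)
    then obtain b w where "v = b # w" by (cases v) auto
    then show ?thesis using ladder by (intro bexI[of _ "L (s = b) w (Suc i)"]) auto
  next
    case (parent v s b)
    then show ?thesis by (intro bexI[of _ "gadget v"]) (auto simp: base_def)
  next
    case (cross v b)
    then show ?thesis by (intro bexI[of _ "L b v 1"]) auto
  next
    case (bipartite j a b)
    then show ?thesis by (intro bexI[of _ "K j 0"]) (auto simp: K33_verts_def)
  qed
  then show "\<exists>t\<in>nodes h n. x \<in> node_bag t \<and> y \<in> node_bag t" if "(x, y) \<in> parcs (ladder_graph h n)" for x y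
    using that unfolding arc_iff_half by blast
qed

lemma coloured_decomposition_nodes:
  assumes "0 < h"
  shows "coloured_decomposition (nodes h n) (gadget []) node_parent node_rank (ladder_graph h n)
    node_bag top_node colour"
proof (rule coloured_decomposition.intro[OF rooted_decomposition_nodes[OF assms]],
      rule coloured_decomposition_axioms.intro)
  have "colour x \<noteq> colour y" if "half_arc h n x y" for x y
    using that by cases auto
  then show "colour x \<noteq> colour y" if "(x, y) \<in> parcs (ladder_graph h n)" for x y
    using that unfolding arc_iff_half by metis
  show "inj_on colour (node_bag t \<inter> node_bag (node_parent t))"
    if "t \<in> nodes h n" "t \<noteq> gadget []" for t
    using that(1)
  proof (cases rule: nodes_cases)
    case (gadget v)
    then have "v \<noteq> []" using that(2) by auto
    then have "node_bag t \<inter> node_bag (node_parent t) \<subseteq> {base True v, base False v}"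
      using gadget by (cases v) auto
    then show ?thesis by (rule inj_on_subset[rotated]) (auto simp: inj_on_def)
  next
    case (rung s v i)
    then have "node_bag t \<inter> node_bag (node_parent t) \<subseteq> {L s (True # v) i, L (\<not> s) (False # v) i}"
      by auto
    then show ?thesis by (rule inj_on_subset[rotated]) (auto simp: inj_on_def)
  next
    case (last_rung s v)
    then have "node_bag t \<inter> node_bag (node_parent t) \<subseteq>
        {L s (True # v) (Suc (length v)), L (\<not> s) (False # v) (Suc (length v))}"
      by (auto simp: base_def)
    then show ?thesis by (rule inj_on_subset[rotated]) (auto simp: inj_on_def)
  next
    case (K33 j)
    then show ?thesis by (auto simp: K33_verts_def inj_on_def)
  qed
  show "card {x \<in> node_bag t. colour x = c} \<le> 3" if "t \<in> nodes h n" for t c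
    using that
  proof (cases rule: nodes_cases)
    case (gadget v)
    let ?s = "c \<noteq> even (length v)"
    have "{x \<in> node_bag t. colour x = c} \<subseteq>
        {base ?s v, base (\<not> ?s) (True # v), base (\<not> ?s) (False # v)}"
      using gadget by auto
    then show ?thesis by (rule card_3)
  next
    case (rung s v i)
    let ?i = "if c = (s \<noteq> even i) then i else i - 1"
    let ?j = "if c = (s \<noteq> even i) then i - 1 else i"
    \<comment> \<open>A rung has two vertices of each colour; \<open>0\<close> pads the set to the
      three elements of \<open>card_3\<close>.\<close>
    have "{x \<in> node_bag t. colour x = c} \<subseteq> {L s (True # v) ?i, L (\<not> s) (False # v) ?j, 0}"
      using rung by auto
    then show ?thesis by (rule card_3)
  next
    case (last_rung s v)
    let ?l = "length v"
    let ?i = "if c = (s = even ?l) then Suc ?l else ?l"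
    let ?j = "if c = (s = even ?l) then ?l else Suc ?l"
    have "{x \<in> node_bag t. colour x = c} \<subseteq> {L s (True # v) ?i, L (\<not> s) (False # v) ?j, 0}"
      using last_rung by auto
    then show ?thesis by (rule card_3)
  next
    case (K33 j)
    let ?a = "if c then 0 else 1"
    have "{x \<in> node_bag t. colour x = c} \<subseteq> {K j ?a, K j (?a + 2), K j (?a + 4)}"
      using K33 by (auto simp: K33_verts_def less_6)
    then show ?thesis by (rule card_3)
  qed
qed

section \<open>The Euler genus\<close>

lemma card_short_lists: "card {v :: bool list. length v < h} + 1 = 2 ^ h"
proof (induction h)
  case (Suc h)
  have "{v :: bool list. length v < Suc h} = {v. length v < h} \<union> {v. length v = h}" by auto
  moreover have "finite {v :: bool list. length v < h}" "finite {v :: bool list. length v = h}"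
    using finite_lists_length_le[of "UNIV :: bool set" h] by (auto elim!: finite_subset[rotated])
  moreover have "card {v :: bool list. length v = h} = 2 ^ h"
    using card_lists_length_eq[of "UNIV :: bool set" h] by simp
  ultimately show ?case using Suc by (simp add: card_Un_disjoint disjoint_iff)
qed simp

lemma finite_short_lists: "finite {v :: bool list. length v \<le> h}"
  using finite_lists_length_le[of "UNIV :: bool set" h] by simp

lemma sum_if_const:
  fixes c :: nat
  assumes "finite A"
  shows "(\<Sum>x\<in>A. if Q x then c else 0) = c * card {x \<in> A. Q x}"
proof -
  have "{x \<in> A. Q x} = A \<inter> {x. Q x}" by blast
  then show ?thesis using sum.If_cases[OF assms, of Q "\<lambda>_. c" "\<lambda>_. 0"] by simp
qed

lemma sum_main_verts:
  "(\<Sum>x\<in>main_verts h. f x) = (\<Sum>s\<in>UNIV. \<Sum>v | length v \<le> h. \<Sum>i\<le>length v. f (L s v i))"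
proof -
  let ?I = "UNIV \<times> Sigma {v. length v \<le> h} (\<lambda>v. {..length v})"
  have "main_verts h = (\<lambda>(s, v, i). L s v i) ` ?I" by (force simp: main_verts_def)
  moreover have "inj_on (\<lambda>(s, v, i). L s v i) ?I" by (auto simp: inj_on_def)
  ultimately have "(\<Sum>x\<in>main_verts h. f x) = (\<Sum>(s, v, i)\<in>?I. f (L s v i))"
    by (simp add: sum.reindex case_prod_unfold)
  also have "\<dots> = (\<Sum>s\<in>UNIV. \<Sum>(v, i)\<in>Sigma {v. length v \<le> h} (\<lambda>v. {..length v}). f (L s v i))"
    by (simp add: sum.cartesian_product)
  also have "\<dots> = (\<Sum>s\<in>UNIV. \<Sum>v | length v \<le> h. \<Sum>i\<le>length v. f (L s v i))"
    by (simp add: sum.Sigma finite_short_lists)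
  finally show ?thesis .
qed

lemma length_nbrs:
  assumes "i \<le> length v"
  shows "length (nbrs h (L s v i)) =
    (if i < length v then 2 else (if v = [] then 0 else 2) + (if length v < h then 2 else 0))"
  using assms by (auto simp: nbrs_L parent_nbrs_def child_nbrs_def split: list.splits)

text \<open>The left sum is twice the number of edges, so this says |E| - |V| =
  \<open>2 ^ (h + 1) - 4\<close>, freed of subtraction. Inner path vertices have degree 2 and cancel
  against their share of \<open>2 * card (main_verts h)\<close>, leaving only the bases to be
  counted.\<close>

lemma degree_sum_main:
  assumes "0 < h"
  shows "(\<Sum>x\<in>main_verts h. length (nbrs h x)) + 8 = 2 * card (main_verts h) + 2 ^ (h + 2)"
proof -
  let ?W = "{v :: bool list. length v \<le> h}"
  define d where "d v = (if v = [] then 0 else 2) + (if length v < h then 2 else 0 :: nat)" for v :: "bool list"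
  have "(\<Sum>i\<le>length v. length (nbrs h (L s v i))) = 2 * length v + d v" for s v
  proof -
    have "(\<Sum>i\<le>length v. length (nbrs h (L s v i))) =
        (\<Sum>i<length v. length (nbrs h (L s v i))) + length (nbrs h (L s v (length v)))"
      by (simp add: lessThan_Suc_atMost[symmetric])
    also have "(\<Sum>i<length v. length (nbrs h (L s v i))) = (\<Sum>i<length v. 2)"
      by (intro sum.cong) (auto simp: length_nbrs)
    finally show ?thesis by (simp add: length_nbrs d_def)
  qed
  then have deg: "(\<Sum>x\<in>main_verts h. length (nbrs h x)) = 2 * (\<Sum>v\<in>?W. 2 * length v + d v)"
    by (simp add: sum_main_verts UNIV_bool)
  have V: "card (main_verts h) = 2 * (\<Sum>v\<in>?W. length v + 1)"
    using sum_main_verts[of "\<lambda>_. 1 :: nat" h] by (simp add: UNIV_bool)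
  define S1 where "S1 = (\<Sum>v\<in>?W. if v = [] then 0 else 2 :: nat)"
  define S2 where "S2 = (\<Sum>v\<in>?W. if length v < h then 2 else 0 :: nat)"
  define l where "l = (\<Sum>v\<in>?W. length v)"
  define w where "w = card ?W"
  define w' where "w' = card {v :: bool list. length v < h}"
  have "S1 + 2 = 2 * w"
  proof -
    have "[] \<in> ?W" by simp
    then have "S1 = (\<Sum>v\<in>?W - {[]}. if v = [] then 0 else 2)"
      unfolding S1_def
      using sum.remove[OF finite_short_lists, of "[]" h "\<lambda>v. if v = [] then 0 else 2 :: nat"] by simp
    also have "\<dots> = (\<Sum>v\<in>?W - {[]}. 2)" by (rule sum.cong) auto
    also have "\<dots> = 2 * card (?W - {[]})" by (simp only: sum_constant mult.commute of_nat_id)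
    finally show ?thesis
      unfolding w_def
      by (metis card.remove[OF finite_short_lists \<open>[] \<in> ?W\<close>] mult_Suc_right add.commute)
  qed
  moreover have "S2 = 2 * w'"
  proof -
    have "{v \<in> ?W. length v < h} = {v. length v < h}" by auto
    then show ?thesis
      unfolding S2_def w'_def
      using sum_if_const[OF finite_short_lists[of h], of "\<lambda>v. length v < h" 2] by metis
  qed
  moreover have "(\<Sum>v\<in>?W. d v) = S1 + S2"
    unfolding d_def S1_def S2_def by (rule sum.distrib)
  moreover have "w' + 1 = 2 ^ h" unfolding w'_def by (rule card_short_lists)
  moreover have "(\<Sum>v\<in>?W. 2 * length v + d v) = 2 * l + (\<Sum>v\<in>?W. d v)"
    unfolding l_def by (simp only: sum.distrib sum_distrib_left)
  moreover have "(\<Sum>v\<in>?W. length v + 1) = l + w"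
    unfolding l_def w_def by (simp only: sum.distrib card_eq_sum)
  moreover have "(2 :: nat) ^ (h + 2) = 4 * 2 ^ h" by simp
  ultimately show ?thesis unfolding deg V by simp
qed

lemma main_vertsE:
  assumes "x \<in> main_verts h"
  obtains s v i where "x = L s v i" "i \<le> length v" "length v \<le> h"
  using assms by (auto simp: main_verts_def)

section \<open>The connected components and their contributions to the Euler genus\<close>

definition components :: "nat \<Rightarrow> nat \<Rightarrow> nat set set" where
  "components h n = insert (main_verts h) (K33_verts ` {..<n})"

lemma Union_components: "\<Union>(components h n) = pverts (ladder_graph h n)"
  by (simp add: components_def pverts_ladder_graph)

lemma components_disjoint:
  "C \<in> components h n \<Longrightarrow> D \<in> components h n \<Longrightarrow> C \<noteq> D \<Longrightarrow> C \<inter> D = {}"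
  by (auto simp: components_def main_verts_def K33_verts_def)

lemma arc_same_component:
  assumes "(x, y) \<in> parcs (ladder_graph h n)" "C \<in> components h n" "x \<in> C"
  shows "y \<in> C"
proof -
  have "x \<in> C \<longleftrightarrow> y \<in> C" if "half_arc h n x y" for x y
    using that assms(2)
    by cases (auto simp: components_def main_verts_def K33_verts_def)
  then show ?thesis using assms(1,3) unfolding arc_iff_half by blast
qed

lemma relpow_imp_rtrancl: "p \<in> R ^^ m \<Longrightarrow> p \<in> R\<^sup>*"
  using rtrancl_power by blast

lemma main_connected:
  assumes "0 < h" "x \<in> main_verts h" "y \<in> main_verts h"
  shows "(x, y) \<in> (parcs (ladder_graph h n))\<^sup>*"
proof -
  let ?R = "(parcs (ladder_graph h n))\<^sup>*"
  have sym: "(y, x) \<in> ?R" if "(x, y) \<in> ?R" for x y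
    using that sym_rtrancl[OF sym_parcs_ladder_graph] by (auto dest: symD)
  have 1: "(L s v i, base s v) \<in> ?R" if "i \<le> length v" "length v \<le> h" for s v i
  proof -
    have "(L s v i, L s v 0) \<in> ?R" "(base s v, L s v 0) \<in> ?R"
      unfolding base_def using that walk_ladder relpow_imp_rtrancl by blast+
    then show ?thesis using sym rtrancl_trans by metis
  qed
  have 2: "(base s v, base s []) \<in> ?R" if "length v \<le> h" for s v
    using walk_base[of v "[]" h s n] that relpow_imp_rtrancl by simp
  \<comment> \<open>The two copies are linked by a crossing between children of their roots, which
    exists because \<open>h\<close> is positive.\<close>
  have "(L True [True] 0, L False [False] 0) \<in> parcs (ladder_graph h n)"
    using arc_cross[of "[]" h True True n] assms(1) by simp
  moreover have "(L True [True] 0, base True []) \<in> ?R" "(L False [False] 0, base False []) \<in> ?R"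
    using rtrancl_trans[OF 1 2] assms(1) by auto
  ultimately have 3: "(base True [], base False []) \<in> ?R"
    using sym rtrancl_trans by (meson r_into_rtrancl)
  have 4: "(x, base True []) \<in> ?R" if xm: "x \<in> main_verts h" for x
  proof -
    obtain s v i where x: "x = L s v i" "i \<le> length v" "length v \<le> h"
      using xm by (rule main_vertsE)
    then have x: "(x, base s []) \<in> ?R" using rtrancl_trans[OF 1 2] by blast
    show ?thesis
    proof (cases s)
      case True
      then show ?thesis using x by simp
    next
      case False
      then show ?thesis using x rtrancl_trans[OF _ sym[OF 3]] by simp
    qed
  qed
  show ?thesis using 4[OF assms(2)] sym[OF 4[OF assms(3)]] by (rule rtrancl_trans)
qed

lemma arc_K: "(K j a, K j' b) \<in> parcs (ladder_graph h n) \<longleftrightarrow> j = j' \<and> j < n \<and> a < 6 \<and> b < 6 \<and> even a \<noteq> even b"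
  by (auto simp: parcs_ladder_graph set_nbrs_K)

lemma K33_connected:
  assumes "j < n" "a < 6" "b < 6"
  shows "(K j a, K j b) \<in> (parcs (ladder_graph h n))\<^sup>*"
proof (cases "even a = even b")
  case True
  define c :: nat where "c = (if even a then 1 else 0)"
  have "(K j a, K j c) \<in> parcs (ladder_graph h n)" "(K j c, K j b) \<in> parcs (ladder_graph h n)"
    using assms True by (auto simp: arc_K c_def)
  then show ?thesis by auto
next
  case False
  then show ?thesis using assms by (intro r_into_rtrancl) (simp add: arc_K)
qed

lemma nbrs_ne:
  assumes "0 < h" "x \<in> pverts (ladder_graph h n)"
  shows "nbrs h x \<noteq> []"
  using assms(2)
proof (cases rule: graph_cases)
  case (main s v i)
  then show ?thesis
    using assms(1) by (cases v) (auto simp: nbrs_L parent_nbrs_def child_nbrs_def)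
qed (simp add: nbrs_K)

lemma K33_card: "card (K33_verts j) = 6"
  unfolding K33_verts_def by (subst card_image) (auto simp: inj_on_def)

lemma inj_K33_verts: "inj K33_verts"
  by (force simp: inj_on_def K33_verts_def)

lemma main_notin_K33: "main_verts h \<notin> K33_verts ` A"
  by (force simp: main_verts_def K33_verts_def)

locale graph_scheme = scheme "ladder_graph h n" rot tw for h n rot tw +
  assumes h: "0 < h"
begin

lemma component_in:
  assumes "C \<in> components h n"
  shows "component C"
proof -
  have "arc_closed C"
    using arc_same_component[OF _ assms] Union_components assms unfolding arc_closed_def by blast
  moreover have "C \<noteq> {} \<and> (\<forall>u\<in>C. \<forall>v\<in>C. (u, v) \<in> (parcs (ladder_graph h n))\<^sup>*)"
  proof (cases "C = main_verts h")
    case True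
    have "L True [] 0 \<in> main_verts h" unfolding main_verts_def by fastforce
    then show ?thesis using True main_connected[OF h] by blast
  next
    case False
    then obtain j where j: "j < n" "C = K j ` {..<6}"
      using assms by (auto simp: components_def K33_verts_def)
    have "K j 0 \<in> C" unfolding j(2) by simp
    then show ?thesis using K33_connected[OF j(1)] unfolding j(2) by blast
  qed
  ultimately show ?thesis by (simp add: component_def)
qed

lemma genus_eq:
  "scheme_euler_genus (ladder_graph h n) rot tw =
    2 - int (card (main_verts h)) + int (card (edges (main_verts h))) - int (card (faces (main_verts h)))
    + (\<Sum>j<n. 2 - 6 + int (card (edges (K33_verts j))) - int (card (faces (K33_verts j))))"
proof -
  have "out x \<noteq> {}" if x: "x \<in> pverts (ladder_graph h n)" for x
  proof -
    have "hd (nbrs h x) \<in> set (nbrs h x)" using nbrs_ne[OF h x] by simp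
    then have "(x, hd (nbrs h x)) \<in> out x" using x by (simp add: parcs_ladder_graph)
    then show ?thesis by blast
  qed
  then have "scheme_euler_genus (ladder_graph h n) rot tw =
    (\<Sum>C\<in>components h n. 2 - int (card C) + int (card (edges C)) - int (card (faces C)))"
    by (intro euler_genus_sum Union_components component_in components_disjoint)
  also have "\<dots> = 2 - int (card (main_verts h)) + int (card (edges (main_verts h)))
      - int (card (faces (main_verts h)))
    + (\<Sum>C\<in>K33_verts ` {..<n}. 2 - int (card C) + int (card (edges C)) - int (card (faces C)))"
    unfolding components_def by (rule sum.insert) (simp_all add: main_notin_K33)
  also have "(\<Sum>C\<in>K33_verts ` {..<n}. 2 - int (card C) + int (card (edges C)) - int (card (faces C))) =
    (\<Sum>j<n. 2 - 6 + int (card (edges (K33_verts j))) - int (card (faces (K33_verts j))))"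
    by (subst sum.reindex[OF inj_on_subset[OF inj_K33_verts subset_UNIV]]) (simp add: K33_card)
  finally show ?thesis .
qed

lemma card_arcs_in_degrees:
  assumes "C \<subseteq> pverts (ladder_graph h n)"
  shows "card (arcs_in C) = (\<Sum>x\<in>C. length (nbrs h x))"
proof -
  have "arcs_in C = Sigma C (\<lambda>x. set (nbrs h x))"
    using assms by (auto simp: arcs_in_def parcs_ladder_graph)
  moreover have "finite C" using assms fin_verts finite_subset by blast
  ultimately have "card (arcs_in C) = (\<Sum>x\<in>C. card (set (nbrs h x)))" by simp
  also have "\<dots> = (\<Sum>x\<in>C. length (nbrs h x))"
    using assms by (intro sum.cong refl distinct_card distinct_nbrs) blast
  finally show ?thesis .
qed

lemma closed_main: "arc_closed (main_verts h)" and closed_K33: "j < n \<Longrightarrow> arc_closed (K33_verts j)"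
  using component_in by (auto simp: component_def components_def)

lemma edges_main: "card (edges (main_verts h)) + 4 = card (main_verts h) + 2 ^ (h + 1)"
  using card_arcs_in[OF closed_main] degree_sum_main[OF h] card_arcs_in_degrees[of "main_verts h"]
  by (simp add: pverts_ladder_graph)

lemma edges_K33:
  assumes "j < n"
  shows "card (edges (K33_verts j)) = 9"
proof -
  have "K33_verts j \<subseteq> pverts (ladder_graph h n)" using assms by (auto simp: pverts_ladder_graph)
  then have "card (arcs_in (K33_verts j)) = (\<Sum>x\<in>K33_verts j. length (nbrs h x))"
    by (rule card_arcs_in_degrees)
  also have "\<dots> = (\<Sum>x\<in>K33_verts j. 3)"
    by (intro sum.cong refl) (auto simp: K33_verts_def nbrs_K)
  finally show ?thesis using card_arcs_in[OF closed_K33[OF assms]] by (simp add: K33_card)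
qed

text \<open>A copy with F faces contributes 2 - 6 + 9 - F = 5 - F, so these bounds place its Euler
  genus between 1 and 4.\<close>

lemma faces_K33:
  assumes "j < n"
  shows "card (faces (K33_verts j)) \<le> 4" "1 \<le> card (faces (K33_verts j))"
proof -
  have "2 * card (faces (K33_verts j)) \<le> card (edges (K33_verts j))"
  proof (rule card_faces_bipartite[OF closed_K33[OF assms], of colour])
    show "colour u \<noteq> colour v" if "(u, v) \<in> arcs_in (K33_verts j)" for u v
      using that set_nbrs_K by (auto simp: arcs_in_def K33_verts_def parcs_ladder_graph)
    show "rot e \<noteq> e" if e: "e \<in> arcs_in (K33_verts j)" for e
    proof -
      obtain a y where a: "e = (K j a, y)" "a < 6" "(K j a, y) \<in> parcs (ladder_graph h n)"
        using e by (cases e) (auto simp: arcs_in_def K33_verts_def)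
      define b where "b = (if even a then 1 else 0 :: nat)"
      have "(K j a, K j b) \<in> parcs (ladder_graph h n)" "(K j a, K j (b + 2)) \<in> parcs (ladder_graph h n)"
        using a assms by (auto simp: arc_K b_def)
      \<comment> \<open>Of two different neighbours at least one differs from \<open>y\<close>, so
        the vertex has degree at least 2 and \<open>rot\<close> moves the arc.\<close>
      moreover have "y \<noteq> K j b \<or> y \<noteq> K j (b + 2)" by auto
      ultimately show ?thesis unfolding a(1) using rot_no_fixpoint[OF a(3)] by blast
    qed
  qed
  then show "card (faces (K33_verts j)) \<le> 4" using edges_K33[OF assms] by simp
  have "((K j 0, K j 1), True) \<in> states (K33_verts j)"
    using assms by (simp add: states_def arc_K K33_verts_def)
  then have "faces (K33_verts j) \<noteq> {}" unfolding faces_def by blast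
  then show "1 \<le> card (faces (K33_verts j))"
    using fin_faces by (simp add: Suc_leI card_gt_0_iff)
qed

lemma genus_lower: "int n \<le> scheme_euler_genus (ladder_graph h n) rot tw"
proof -
  have "card (main_verts h) + card (faces (main_verts h)) \<le> card (edges (main_verts h)) + 2"
    by (intro euler_inequality component_in) (simp add: components_def)
  moreover have "(\<Sum>j<n. 1) \<le>
      (\<Sum>j<n. 2 - 6 + int (card (edges (K33_verts j))) - int (card (faces (K33_verts j))))"
    using edges_K33 faces_K33 by (intro sum_mono) fastforce
  ultimately show ?thesis unfolding genus_eq by simp
qed

text \<open>The ladder part contributes at most 2 + (\<open>2 ^ (h + 1)\<close> - 4) -
  (\<open>2 ^ h\<close> - 1) = \<open>2 ^ h\<close> - 1, and every K_{3,3} at most 4.\<close>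

lemma genus_upper:
  assumes "2 ^ h \<le> card (faces (main_verts h)) + 1"
  shows "scheme_euler_genus (ladder_graph h n) rot tw \<le> 2 ^ h - 1 + 4 * int n"
proof -
  have "(\<Sum>j<n. 2 - 6 + int (card (edges (K33_verts j))) - int (card (faces (K33_verts j)))) \<le> (\<Sum>j<n. 4)"
    using edges_K33 faces_K33 by (intro sum_mono) fastforce
  moreover have "int (card (edges (main_verts h))) + 4 = int (card (main_verts h)) + 2 * 2 ^ h"
    using arg_cong[OF edges_main, of int] by simp
  moreover have "(2 :: int) ^ h \<le> int (card (faces (main_verts h))) + 1"
    using of_nat_mono[OF assms, where 'a = int] by simp
  ultimately show ?thesis unfolding genus_eq by simp
qed

end

section \<open>The hexagons as faces of an explicit rotation system\<close>

lemma cycle_of_list_next: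
  assumes "distinct (ys @ a # b # zs)"
  shows "cycle_of_list (ys @ a # b # zs) a = b"
  using cycle_of_list_nth[OF assms, of "length ys"] by (simp add: nth_append)

lemma cycle_of_list_last:
  assumes "distinct (b # ys @ [a])"
  shows "cycle_of_list (b # ys @ [a]) a = b"
  using cycle_of_list_nth[OF assms, of "Suc (length ys)"] by (simp add: nth_append)

text \<open>The facial walk along the hexagon of the gadget below \<open>v\<close>, starting at either side.\<close>

inductive on_hexagon :: "bool list \<Rightarrow> nat \<times> nat \<Rightarrow> bool" for v where
  child: "on_hexagon v (base s v, base s (True # v))"
| ascend: "i \<le> length v \<Longrightarrow> on_hexagon v (L s (True # v) (Suc i), L s (True # v) i)"
| cross: "on_hexagon v (L s (True # v) 0, L (\<not> s) (False # v) 0)"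
| descend: "i \<le> length v \<Longrightarrow> on_hexagon v (L s (False # v) i, L s (False # v) (Suc i))"
| parent: "on_hexagon v (base s (False # v), base s v)"

abbreviation "graph_rot h n \<equiv> list_rot (pverts (ladder_graph h n)) (nbrs h)"

lemma graph_rot_next:
  assumes "u \<in> pverts (ladder_graph h n)" "nbrs h u = ys @ a # b # zs"
  shows "graph_rot h n (u, a) = (u, b)"
  using assms distinct_nbrs[OF assms(1)] cycle_of_list_next by (simp add: list_rot_def)

lemma graph_rot_last:
  assumes "u \<in> pverts (ladder_graph h n)" "nbrs h u = b # ys @ [a]"
  shows "graph_rot h n (u, a) = (u, b)"
  using assms distinct_nbrs[OF assms(1)] cycle_of_list_last by (simp add: list_rot_def)

lemma on_hexagon_step:
  assumes "on_hexagon v e" "length v < h"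
  shows "on_hexagon v (graph_rot h n (prod.swap e))"
  using assms(1)
proof cases
  case (child s)
  have "graph_rot h n (base s (True # v), base s v) = (base s (True # v), L s (True # v) (length v))"
    using assms(2)
    by (intro graph_rot_next[where ys = "[]"]) (auto simp: base_def nbrs_L parent_nbrs_def)
  then show ?thesis using child on_hexagon.ascend[of "length v" v s] by (simp add: base_def)
next
  case (ascend i s)
  have "graph_rot h n (L s (True # v) i, L s (True # v) (Suc i)) = (L s (True # v) i, up s (True # v) i)"
    using assms(2) ascend
    by (intro graph_rot_next[where ys = "[]"]) (auto simp: nbrs_L)
  then show ?thesis
    using ascend on_hexagon.cross[of v s] on_hexagon.ascend[of "i - 1" v s]
    by (cases i) (auto simp: up_def sib_def)
next
  case (cross s)
  have "graph_rot h n (L (\<not> s) (False # v) 0, L s (True # v) 0) =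
      (L (\<not> s) (False # v) 0, L (\<not> s) (False # v) (Suc 0))"
    using assms(2) by (intro graph_rot_last[where ys = "[]"]) (auto simp: nbrs_L up_def sib_def)
  then show ?thesis using cross on_hexagon.descend[of 0 v "\<not> s"] by simp
next
  case (descend i s)
  show ?thesis
  proof (cases "i = length v")
    case True
    have "graph_rot h n (base s (False # v), L s (False # v) (length v)) = (base s (False # v), base s v)"
      using assms(2)
      by (intro graph_rot_next[where ys = "[]"]) (auto simp: base_def nbrs_L parent_nbrs_def)
    then show ?thesis using descend True on_hexagon.parent[of v s] by (simp add: base_def)
  next
    case False
    then have "graph_rot h n (L s (False # v) (Suc i), L s (False # v) i) =
        (L s (False # v) (Suc i), L s (False # v) (Suc (Suc i)))"
      using assms(2) descend by (intro graph_rot_last[where ys = "[]"]) (auto simp: nbrs_L up_def)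
    then show ?thesis using descend False on_hexagon.descend[of "Suc i" v s] by simp
  qed
next
  case (parent s)
  have "graph_rot h n (base s v, base s (False # v)) = (base s v, base s (True # v))"
    using assms(2)
    by (intro graph_rot_next[where ys = "parent_nbrs s v"])
      (auto simp: base_def nbrs_L child_nbrs_def)
  then show ?thesis using parent on_hexagon.child[of v s] by simp
qed

text \<open>This arc serves as a label of its hexagon, so different \<open>v\<close> yield different
  faces.\<close>

lemma on_hexagon_unique:
  assumes "on_hexagon v (base True w, base True (True # w))"
  shows "w = v"
  using assms by cases (auto simp: base_def)

lemma graph_rot_scheme: "embedding_scheme (ladder_graph h n) (graph_rot h n) (\<lambda>_. False)"
proof (rule list_rot_scheme)
  show "parcs (ladder_graph h n) = {(u, v). u \<in> pverts (ladder_graph h n) \<and> v \<in> set (nbrs h u)}"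
    using parcs_ladder_graph by auto
qed (rule distinct_nbrs)

lemma graph_schemeI:
  assumes "0 < h" "embedding_scheme (ladder_graph h n) rot tw"
  shows "graph_scheme h n rot tw"
  using assms pair_graph_ladder_graph
  by (intro graph_scheme.intro scheme.intro scheme_axioms.intro graph_scheme_axioms.intro)

lemma card_hexagon_faces:
  assumes "0 < h"
  shows "2 ^ h \<le> card (scheme.faces (ladder_graph h n) (graph_rot h n) (\<lambda>_. False) (main_verts h)) + 1"
proof -
  interpret graph_scheme h n "graph_rot h n" "\<lambda>_. False"
    by (rule graph_schemeI[OF assms graph_rot_scheme])
  let ?x = "\<lambda>v. ((base True v, base True (True # v)), True)"
  let ?V = "{v :: bool list. length v < h}"
  have x: "?x v \<in> states (main_verts h)" if "v \<in> ?V" for v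
  proof -
    have "(base True v, base True (True # v)) \<in> parcs (ladder_graph h n)"
      using that half_arc.parent[of v h n True True] by (simp add: arc_iff_half base_def)
    then show ?thesis using that by (auto simp: states_def main_verts_def base_def)
  qed
  \<comment> \<open>Without twists \<open>step\<close> keeps the mode and \<open>mirror\<close>
    flips it. The reversed walk thus stays in mode \<open>False\<close>, which is left unrestricted;
    mode \<open>True\<close> suffices to tell the hexagons apart.\<close>
  have sub: "face (?x v) \<subseteq> {e. on_hexagon v e} \<times> {True} \<union> UNIV \<times> {False}" if "v \<in> ?V" for v
  proof (rule face_sub)
    show "step y \<in> {e. on_hexagon v e} \<times> {True} \<union> UNIV \<times> {False}"
      if "y \<in> {e. on_hexagon v e} \<times> {True} \<union> UNIV \<times> {False}" for y
      using that on_hexagon_step[of v _ h n] \<open>v \<in> ?V\<close> by (auto simp: Let_def)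
  qed (auto intro: on_hexagon.child)
  have "inj_on (\<lambda>v. face (?x v)) ?V"
  proof (rule inj_onI)
    fix v w assume vw: "v \<in> ?V" "w \<in> ?V" "face (?x v) = face (?x w)"
    have "?x w \<in> states (pverts (ladder_graph h n))"
      using x[OF vw(2)] states_sub[of "main_verts h" "pverts (ladder_graph h n)"] by (auto simp: pverts_ladder_graph)
    then have "?x w \<in> face (?x v)" using face_self vw(3) by simp
    then have "on_hexagon v (base True w, base True (True # w))" using sub[OF vw(1)] by blast
    then show "v = w" by (rule on_hexagon_unique[symmetric])
  qed
  moreover have "(\<lambda>v. face (?x v)) ` ?V \<subseteq> faces (main_verts h)"
    using x unfolding faces_def by blast
  ultimately have "card ?V \<le> card (faces (main_verts h))"
    using fin_faces by (intro card_inj_on_le)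
  then show ?thesis using card_short_lists[of h] by linarith
qed

theorem euler_genus_graph:
  assumes "0 < h"
  shows "int n \<le> euler_genus (ladder_graph h n)" "euler_genus (ladder_graph h n) \<le> 2 ^ h - 1 + 4 * int n"
proof -
  have lower: "int n \<le> scheme_euler_genus (ladder_graph h n) rot tw"
    if "embedding_scheme (ladder_graph h n) rot tw" for rot tw
    using graph_scheme.genus_lower[OF graph_schemeI[OF assms that]] .
  have upper: "scheme_euler_genus (ladder_graph h n) (graph_rot h n) (\<lambda>_. False) \<le> 2 ^ h - 1 + 4 * int n"
    using graph_scheme.genus_upper[OF graph_schemeI[OF assms graph_rot_scheme] card_hexagon_faces[OF assms]] .
  show "int n \<le> euler_genus (ladder_graph h n)" "euler_genus (ladder_graph h n) \<le> 2 ^ h - 1 + 4 * int n"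
    using euler_genus_bounds[OF lower graph_rot_scheme upper] by blast+
qed

theorem theorem1p7:
  fixes k :: nat
  assumes "k \<ge> 3"
  shows "\<exists>G :: nat pair_pre_digraph. pair_graph G \<and>
    (\<exists>M. comatching G (2 * k - 1) M \<and> card M = 2 ^ k) \<and>
    (\<exists>(T :: nat pair_pre_digraph) bag. tree_decomposition G T bag \<and>
       (\<forall>t \<in> pverts T. card (bag t) \<le> 6) \<and>
       (\<forall>(s, t) \<in> parcs T. card (bag s \<inter> bag t) \<le> 2)) \<and>
    (\<forall>H :: nat pair_pre_digraph. K\<^bsub>3,4\<^esub> (with_proj H) \<longrightarrow> \<not> is_minor H G) \<and>
    (\<forall>H :: nat pair_pre_digraph. K\<^bsub>5\<^esub> (with_proj H) \<longrightarrow> \<not> is_minor H G) \<and>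
    2 ^ (k - 3) \<le> euler_genus G \<and> euler_genus G \<le> 2 ^ k"
proof -
  define h where "h = k - 1"
  define G where "G = ladder_graph h (2 ^ (k - 3))"
  have h: "0 < h" "2 * k - 1 = 2 * h + 1" "k = h + 1" using assms by (auto simp: h_def)
  interpret D: coloured_decomposition "nodes h (2 ^ (k - 3))" "gadget []" node_parent node_rank G
      node_bag top_node colour
    unfolding G_def by (rule coloured_decomposition_nodes[OF h(1)])
  have "comatching G (2 * k - 1) (matching h)" "card (matching h) = 2 ^ k"
    using comatching_matching card_matching h by (simp_all add: G_def)
  moreover have "\<forall>t\<in>pverts D.T. card (node_bag t) \<le> 6"
    using D.card_bag by (simp add: parent_tree_def)
  moreover have "\<forall>(s, t)\<in>parcs D.T. card (node_bag s \<inter> node_bag t) \<le> 2"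
    using D.card_adhesion by blast
  moreover have "2 ^ (k - 3) \<le> euler_genus G" "euler_genus G \<le> 2 ^ k"
  proof -
    \<comment> \<open>This is where \<open>k \<ge> 3\<close> enters: the copies cost
      \<open>4 * 2 ^ (k - 3) = 2 ^ h\<close>, so the upper bound
      \<open>2 ^ h - 1 + 4 * int n\<close> becomes \<open>2 ^ k - 1\<close>.\<close>
    have "(2 :: int) ^ k = 2 ^ h + 4 * 2 ^ (k - 3)"
    proof -
      have "k = Suc h" "h = k - 3 + 2" using assms by (auto simp: h_def)
      then have "(2 :: int) ^ k = 2 * 2 ^ h" "(2 :: int) ^ h = 2 ^ (k - 3) * 2 ^ 2"
        by (metis power_Suc, metis power_add)
      then show ?thesis by simp
    qed
    then show "2 ^ (k - 3) \<le> euler_genus G" "euler_genus G \<le> 2 ^ k"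
      using euler_genus_graph[OF h(1), of "2 ^ (k - 3)"] by (simp_all add: G_def)
  qed
  ultimately show ?thesis
    using D.graph D.tree_decomposition D.no_K34_minor D.no_K5_minor by blast
qed

end
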